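(* Let $a>c>1$ be integers and let $L_h>c$ be an integer. Let $\mathbf{H}_s$ be a binary matrix with $a$ rows and $L_h$ columns whose $i$-th row contains exactly $w_i\ge 1$ ones, $i=0,1,\ldots,a-1$. Let $\mathbf{H}$ be the semi-infinite parity-check matrix obtained from $\mathbf{H}_s$ with shift $c$. If the Tanner graph of $\mathbf{H}$ contains no local cycle of length less than $8$, then $$L_h \ge \max\left\{c+1,\ \left\lceil \frac{2\sum_{i=0}^{a-1}\binom{w_i}{2}}{c}\right\rceil\right\}.$$
   Context: Syndrome former matrix and parity-check matrix: given integers $a>c\ge1$ and a binary $a\times L_h$ matrix $\mathbf{H}_s$ (the syndrome former matrix; rows indexed $0,\ldots,a-1$, columns indexed $0,\ldots,L_h-1$), the semi-infinite binary parity-check matrix $\mathbf{H}$ consists of the transpose $\mathbf{H}_s^T$ and all its replicas, each shifted down by $c$ rows with respect to the previous one. Explicitly, the rows of $\mathbf{H}$ are indexed by integers $n\ge 0$, its columns by pairs $(t,i)$ with $t\ge 0$ an integer and $0\le i\le a-1$, and the entry in row $n$ and column $(t,i)$ is $1$ if and only if $0\le n-tc\le L_h-1$ and the entry of $\mathbf{H}_s$ in row $i$, column $n-tc$ is $1$. Tanner graph: the bipartite graph whose two vertex classes are the rows and the columns of $\mathbf{H}$, a row being adjacent to a column if and only if the corresponding entry of $\mathbf{H}$ is $1$. A local cycle is a closed walk of positive length in the Tanner graph that starts at a node and returns to it, passing at most once through any edge; its length is its number of edges. *)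

theory Defs
  imports Complex_Main "HOL-Library.Z2" "Jordan_Normal_Form.Matrix"
begin

text \<open>Binary matrices are matrices over \<^typ>\<open>bit\<close>.\<close>

definition row_weight :: "bit mat \<Rightarrow> nat \<Rightarrow> nat" where
  "row_weight A i = card {j. j < dim_col A \<and> A $$ (i, j) = 1}"

text \<open>
  The semi-infinite matrix \<open>H\<close> obtained from the syndrome former matrix \<open>Hs\<close> with shift \<open>c\<close>.
  Its rows are the natural numbers; its columns are the pairs \<open>(t, i)\<close> with \<open>i < dim_row Hs\<close>,
  where \<open>(t, i)\<close> is column \<open>i\<close> of the \<open>t\<close>-th replica of the transpose of \<open>Hs\<close>.
  For \<open>i \<ge> dim_row Hs\<close> there is no such column and the value is irrelevant.
\<close>

definition parity_check :: "bit mat \<Rightarrow> nat \<Rightarrow> nat \<Rightarrow> nat \<times> nat \<Rightarrow> bit" where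
  "parity_check Hs c n = (\<lambda>(t, i).
     if t * c \<le> n \<and> n - t * c < dim_col Hs then Hs $$ (i, n - t * c) else 0)"

datatype tanner_node = Row nat | Col "nat \<times> nat"

definition tanner_adj :: "bit mat \<Rightarrow> nat \<Rightarrow> tanner_node \<Rightarrow> tanner_node \<Rightarrow> bool" where
  "tanner_adj Hs c u v \<longleftrightarrow>
     (\<exists>n t i. i < dim_row Hs \<and> parity_check Hs c n (t, i) = 1 \<and>
        (u = Row n \<and> v = Col (t, i) \<or> u = Col (t, i) \<and> v = Row n))"

text \<open>
  A closed walk of length \<open>k\<close> is given by its nodes \<open>p 0, \<dots>, p k\<close>; the values of \<open>p\<close> beyond \<open>k\<close>
  are irrelevant. Its edges are unordered pairs, so an edge may not be used again in
  the opposite direction either. Nodes may be repeated.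
\<close>

definition local_cycle :: "('v \<Rightarrow> 'v \<Rightarrow> bool) \<Rightarrow> nat \<Rightarrow> (nat \<Rightarrow> 'v) \<Rightarrow> bool" where
  "local_cycle adj k p \<longleftrightarrow>
     0 < k \<and> p k = p 0 \<and> (\<forall>j<k. adj (p j) (p (Suc j))) \<and>
     inj_on (\<lambda>j. {p j, p (Suc j)}) {..<k}"

end

theory Submission imports Defs "HOL-Analysis.Function_Topology" begin

text \<open>
  Join two integers if the corresponding rows of \<open>H\<close> have a common column (a ``line''). Without local
  cycles of length below 8, two lines meet in at most one point and every triangle of this \<open>c\<close>-periodic
  graph lies in a single line. The sum of the degrees of \<open>c\<close> consecutive points is
  \<open>2 * (\<Sum>i. w i choose 2)\<close>, so the claim is that the average degree is at most \<open>L = m * c + s\<close>.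

  Suppose it is not. For \<open>m \<ge> 2\<close> maximise, in the spirit of Motzkin and Straus, the excess over this
  bound (a quadratic form) over all weightings of the residue classes by numbers in \<open>[0, 1]\<close>. At the
  maximum every point of the support has weighted degree above the value \<open>V\<close> of the bound at it. A line
  carrying three or more points of the support is then impossible: no outer point sees two of its points, so
  their degrees add up to too little. Hence the support is triangle-free. Let \<open>v\<close> be the farthest
  right neighbour of \<open>u\<close>. The right neighbours of \<open>u\<close> and the left neighbours of \<open>v\<close> are disjoint subsets of a
  window of weight at most \<open>V v\<close>, so \<open>v\<close> has larger right degree than \<open>u\<close>, which is absurd for \<open>u\<close> of
  maximal right degree.

  For \<open>m = 1\<close> the real weighting fails (a line on \<open>c + 1\<close> consecutive points attains the bound and is improved
  by fractional weights); a minimal set of residue classes violating the bound replaces the maximum.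
\<close>

section \<open>Quadratic forms on the unit cube\<close>

lemma quadratic_form_fun_upd:
  fixes M :: "'i \<Rightarrow> 'i \<Rightarrow> real"
  assumes "finite I" "k \<in> I" "\<And>i j. i \<in> I \<Longrightarrow> j \<in> I \<Longrightarrow> M i j = M j i"
  shows "(\<Sum>i\<in>I. \<Sum>j\<in>I. M i j * (q(k := q k + h)) i * (q(k := q k + h)) j) =
    (\<Sum>i\<in>I. \<Sum>j\<in>I. M i j * q i * q j) + 2 * h * (\<Sum>j\<in>I. M k j * q j) + h\<^sup>2 * M k k"
proof -
  define e where "e i = (if i = k then h else 0)" for i
  have upd: "(q(k := q k + h)) i = q i + e i" for i by (simp add: e_def)
  have "(\<Sum>i\<in>I. \<Sum>j\<in>I. M i j * (q i + e i) * (q j + e j)) =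
     (\<Sum>i\<in>I. \<Sum>j\<in>I. M i j * q i * q j) + (\<Sum>i\<in>I. \<Sum>j\<in>I. M i j * e i * q j)
     + (\<Sum>i\<in>I. \<Sum>j\<in>I. M i j * q i * e j) + (\<Sum>i\<in>I. \<Sum>j\<in>I. M i j * e i * e j)"
    unfolding sum.distrib[symmetric] by (intro sum.cong refl) (simp add: algebra_simps)
  also have "(\<Sum>i\<in>I. \<Sum>j\<in>I. M i j * e i * q j) = (\<Sum>i\<in>I. if i = k then h * (\<Sum>j\<in>I. M i j * q j) else 0)"
    by (intro sum.cong refl) (auto simp: e_def sum_distrib_left mult_ac)
  also have "\<dots> = h * (\<Sum>j\<in>I. M k j * q j)" using assms by simp
  also have "(\<Sum>i\<in>I. \<Sum>j\<in>I. M i j * q i * e j) = (\<Sum>i\<in>I. \<Sum>j\<in>I. if j = k then M i j * q i * h else 0)"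
    by (intro sum.cong refl) (auto simp: e_def)
  also have "\<dots> = (\<Sum>i\<in>I. M i k * q i * h)" using assms by simp
  also have "\<dots> = h * (\<Sum>j\<in>I. M k j * q j)" unfolding sum_distrib_left
    using assms by (intro sum.cong refl) auto
  also have "(\<Sum>i\<in>I. \<Sum>j\<in>I. M i j * e i * e j) = (\<Sum>i\<in>I. if i = k then (\<Sum>j\<in>I. if j = k then M i j * h * h else 0) else 0)"
    by (intro sum.cong refl) (auto simp: e_def intro!: sum.cong)
  also have "\<dots> = h\<^sup>2 * M k k" using assms by (simp add: power2_eq_square)
  finally show ?thesis unfolding upd by simp
qed

text \<open>The cube is taken over the whole index type, so its compactness is Tychonoff's theorem;
  the form is continuous in the product topology.\<close>

lemma box_maximum_exists:
  fixes M :: "'i \<Rightarrow> 'i \<Rightarrow> real"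
  shows "\<exists>q. (\<forall>i. 0 \<le> q i \<and> q i \<le> 1) \<and>
    (\<forall>q'. (\<forall>i. 0 \<le> q' i \<and> q' i \<le> 1) \<longrightarrow>
      (\<Sum>i\<in>I. \<Sum>j\<in>I. M i j * q' i * q' j) \<le> (\<Sum>i\<in>I. \<Sum>j\<in>I. M i j * q i * q j))"
proof -
  let ?D = "PiE UNIV (\<lambda>_::'i. {0..1::real})"
  have "compactin (product_topology (\<lambda>i. euclidean) UNIV) ?D"
    unfolding compactin_PiE by simp
  hence cpt: "compact ?D" unfolding euclidean_product_topology by simp
  have ne: "?D \<noteq> {}" by (simp add: PiE_eq_empty_iff)
  have cont: "continuous_on ?D (\<lambda>q. \<Sum>i\<in>I. \<Sum>j\<in>I. M i j * q i * q j)"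
    by (intro continuous_on_sum continuous_on_mult continuous_on_const
        continuous_on_subset[OF continuous_on_product_coordinates subset_UNIV])
  obtain q where q: "q \<in> ?D" "\<forall>q'\<in>?D. (\<Sum>i\<in>I. \<Sum>j\<in>I. M i j * q' i * q' j) \<le> (\<Sum>i\<in>I. \<Sum>j\<in>I. M i j * q i * q j)"
    using continuous_attains_sup[OF cpt ne cont] by (elim bexE) (rule that)
  show ?thesis
  proof (intro exI[of _ q] conjI allI impI)
    show "0 \<le> q i" "q i \<le> 1" for i using q(1) by (auto simp: PiE_iff)
    fix q' :: "'i \<Rightarrow> real" assume "\<forall>i. 0 \<le> q' i \<and> q' i \<le> 1"
    hence "q' \<in> ?D" by auto
    thus "(\<Sum>i\<in>I. \<Sum>j\<in>I. M i j * q' i * q' j) \<le> (\<Sum>i\<in>I. \<Sum>j\<in>I. M i j * q i * q j)"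
      using q(2) by blast
  qed
qed

text \<open>First-order conditions: moving coordinate \<open>k\<close> by \<open>h\<close> changes
  the form by \<open>2 * h * g + h\<^sup>2 * M k k\<close>, where \<open>2 * g\<close> is the
  partial derivative, so \<open>g\<close> has a restricted sign wherever \<open>q k\<close> can
  move. The last property compares the maximum with all weights equal to 1.\<close>

lemma box_maximum:
  fixes M :: "'i \<Rightarrow> 'i \<Rightarrow> real"
  assumes fin: "finite I" and sym: "\<And>i j. i \<in> I \<Longrightarrow> j \<in> I \<Longrightarrow> M i j = M j i"
  obtains q where "\<And>i. 0 \<le> q i" "\<And>i. q i \<le> 1"
    "\<And>i. i \<in> I \<Longrightarrow> 0 < q i \<Longrightarrow> 0 \<le> (\<Sum>j\<in>I. M i j * q j)"
    "\<And>i. i \<in> I \<Longrightarrow> q i < 1 \<Longrightarrow> (\<Sum>j\<in>I. M i j * q j) \<le> 0"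
    "(\<Sum>i\<in>I. \<Sum>j\<in>I. M i j) \<le> (\<Sum>i\<in>I. \<Sum>j\<in>I. M i j * q i * q j)"
proof -
  obtain q where q': "\<forall>i. 0 \<le> q i \<and> q i \<le> 1" and
    mx: "\<forall>q'. (\<forall>i. 0 \<le> q' i \<and> q' i \<le> 1) \<longrightarrow>
      (\<Sum>i\<in>I. \<Sum>j\<in>I. M i j * q' i * q' j) \<le> (\<Sum>i\<in>I. \<Sum>j\<in>I. M i j * q i * q j)"
    using box_maximum_exists[of M I] by (elim exE conjE) (rule that)
  have q: "0 \<le> q i" "q i \<le> 1" for i using q' by auto
  have var: "2 * h * (\<Sum>j\<in>I. M k j * q j) + h\<^sup>2 * M k k \<le> 0"
    if "k \<in> I" "0 \<le> q k + h" "q k + h \<le> 1" for k h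
    proof -
    have "(\<Sum>i\<in>I. \<Sum>j\<in>I. M i j * (q(k := q k + h)) i * (q(k := q k + h)) j) \<le> (\<Sum>i\<in>I. \<Sum>j\<in>I. M i j * q i * q j)"
      using that q by (intro mx[rule_format]) auto
    thus ?thesis using quadratic_form_fun_upd[where M = M and I = I and k = k and q = q and h = h] fin sym that by simp
  qed
  have small: "\<exists>t. 0 < t \<and> t \<le> u \<and> 0 < 2 * t * g + t\<^sup>2 * b" if "0 < u" "0 < g" for u g b :: real
  proof -
    \<comment> \<open>Small enough for the linear term to dominate; the \<open>+ 1\<close> keeps the
      denominator positive when \<open>b = 0\<close>.\<close>
    define t where "t = min u (g / (\<bar>b\<bar> + 1))"
    have t: "0 < t" "t \<le> u" "t \<le> g / (\<bar>b\<bar> + 1)" using that by (auto simp: t_def)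
    have "t * (\<bar>b\<bar> + 1) \<le> g" using t(3) by (simp add: field_simps)
    moreover have "t * (\<bar>b\<bar> + 1) = t * \<bar>b\<bar> + t" by (simp add: algebra_simps)
    ultimately have "t * \<bar>b\<bar> < 2 * g" using that t(1) by linarith
    moreover have "- (t * \<bar>b\<bar>) \<le> t * b" using mult_left_mono[of "- \<bar>b\<bar>" b t] t(1) by simp
    ultimately have "0 < 2 * g + t * b" by linarith
    hence "0 < t * (2 * g + t * b)" using t(1) by simp
    thus ?thesis using t by (intro exI[of _ t]) (simp add: algebra_simps power2_eq_square)
  qed
  show ?thesis
  proof (rule that[of q])
    fix k assume k: "k \<in> I" "0 < q k"
    show "0 \<le> (\<Sum>j\<in>I. M k j * q j)"
    proof (rule ccontr)
      assume "\<not> ?thesis"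
      then obtain t where t: "0 < t" "t \<le> q k" "0 < 2 * t * (- (\<Sum>j\<in>I. M k j * q j)) + t\<^sup>2 * M k k"
        using small[of "q k" "- (\<Sum>j\<in>I. M k j * q j)" "M k k"] k by auto
      thus False using var[of k "- t"] k q(2)[of k] by simp
    qed
  next
    fix k assume k: "k \<in> I" "q k < 1"
    show "(\<Sum>j\<in>I. M k j * q j) \<le> 0"
    proof (rule ccontr)
      assume "\<not> ?thesis"
      then obtain t where t: "0 < t" "t \<le> 1 - q k" "0 < 2 * t * (\<Sum>j\<in>I. M k j * q j) + t\<^sup>2 * M k k"
        using small[of "1 - q k" "\<Sum>j\<in>I. M k j * q j" "M k k"] k by auto
      thus False using var[of k t] k q(1)[of k] by simp
    qed
  next
    show "(\<Sum>i\<in>I. \<Sum>j\<in>I. M i j) \<le> (\<Sum>i\<in>I. \<Sum>j\<in>I. M i j * q i * q j)"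
      using mx[rule_format, of "\<lambda>_. 1"] by simp
  qed (use q in auto)
qed

section \<open>Periodic systems of lines\<close>

text \<open>For \<open>l = (i, t)\<close> this is the translate of \<open>A i\<close> by
  \<open>t * c\<close>. It is empty for an index outside \<open>I\<close>, so that \<open>l\<close>
  can range over the full type.\<close>

definition shifted_line :: "'i set \<Rightarrow> ('i \<Rightarrow> int set) \<Rightarrow> int \<Rightarrow> 'i \<times> int \<Rightarrow> int set" where
  "shifted_line I A c l = {x. fst l \<in> I \<and> x - snd l * c \<in> A (fst l)}"

text \<open>Points and translations range over all integers, which makes the system invariant under
  translation by \<open>c\<close>. The window length is split as \<open>m * c + s\<close> by
  division with remainder. \<open>two_lines\<close> and \<open>three_lines\<close> exclude 4-cycles
  and 6-cycles of the incidence graph of points and lines.\<close>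

locale shifted_lines =
  fixes I :: "'i set" and A :: "'i \<Rightarrow> int set" and c m s :: int
  assumes finite_I: "finite I" and c_pos: "0 < c" and m_ge: "1 \<le> m" and s_nonneg: "0 \<le> s" and s_less: "s < c"
    and A_subset: "i \<in> I \<Longrightarrow> A i \<subseteq> {0..<m * c + s}"
    and two_lines: "l \<noteq> l' \<Longrightarrow> x \<in> shifted_line I A c l \<Longrightarrow> x \<in> shifted_line I A c l' \<Longrightarrow>
      y \<in> shifted_line I A c l \<Longrightarrow> y \<in> shifted_line I A c l' \<Longrightarrow> x = y"
    and three_lines: "l1 \<noteq> l2 \<Longrightarrow> l2 \<noteq> l3 \<Longrightarrow> l3 \<noteq> l1 \<Longrightarrow> x \<noteq> y \<Longrightarrow> y \<noteq> z \<Longrightarrow> z \<noteq> x \<Longrightarrow>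
      x \<in> shifted_line I A c l1 \<Longrightarrow> x \<in> shifted_line I A c l2 \<Longrightarrow>
      y \<in> shifted_line I A c l2 \<Longrightarrow> y \<in> shifted_line I A c l3 \<Longrightarrow>
      z \<in> shifted_line I A c l3 \<Longrightarrow> z \<in> shifted_line I A c l1 \<Longrightarrow> False"
begin

abbreviation line :: "'i \<times> int \<Rightarrow> int set" where "line \<equiv> shifted_line I A c"

definition adj :: "int \<Rightarrow> int \<Rightarrow> bool" where
  "adj x y \<longleftrightarrow> x \<noteq> y \<and> (\<exists>l. x \<in> line l \<and> y \<in> line l)"

text \<open>Each line lies in a window of length \<open>m * c + s\<close> that starts at a multiple
  of \<open>c\<close>. \<open>lo x\<close> is the start of the first such window containing
  \<open>x\<close>, and \<open>hi x\<close> the exclusive end of the last one.\<close>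

definition lo :: "int \<Rightarrow> int" where "lo x = c * ((x - (m * c + s)) div c + 1)"
definition hi :: "int \<Rightarrow> int" where "hi x = c * (x div c) + (m * c + s)"

lemma line_shift: "x + k * c \<in> line (i, t + k) \<longleftrightarrow> x \<in> line (i, t)"
  by (simp add: shifted_line_def algebra_simps)

lemma adj_sym: "adj x y \<longleftrightarrow> adj y x"
  unfolding adj_def by auto

lemma adj_shift_imp: "adj x y \<Longrightarrow> adj (x + k * c) (y + k * c)"
  unfolding adj_def using line_shift by fastforce

lemma adj_shift: "adj (x + k * c) (y + k * c) \<longleftrightarrow> adj x y"
  using adj_shift_imp[of x y k] adj_shift_imp[of "x + k * c" "y + k * c" "- k"] by auto

lemma line_bounds:
  assumes "x \<in> line l"
  shows "snd l * c \<le> x" "x < snd l * c + (m * c + s)"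
  using assms A_subset[of "fst l"] by (auto simp: shifted_line_def)

lemma line_block_bounds:
  assumes "x \<in> line l"
  shows "snd l \<le> x div c" "x div c \<le> snd l + m" "x div c = snd l + m \<Longrightarrow> x mod c < s"
proof -
  note x = line_bounds[OF assms]
  have "snd l = (snd l * c) div c" using c_pos by simp
  also have "\<dots> \<le> x div c" using x c_pos by (intro zdiv_mono1) auto
  finally show "snd l \<le> x div c" .
  have xd: "x = (x div c) * c + x mod c" "0 \<le> x mod c" using c_pos by auto
  show "x div c \<le> snd l + m"
  proof (rule ccontr)
    assume "\<not> ?thesis"
    hence "(snd l + m + 1) * c \<le> (x div c) * c" using c_pos by (intro mult_right_mono) auto
    moreover have "(snd l + m + 1) * c = snd l * c + m * c + c" by (simp add: algebra_simps)
    ultimately show False using xd x s_less by linarith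
  qed
  show "x mod c < s" if "x div c = snd l + m"
    using xd(1) x unfolding that by (simp add: algebra_simps)
qed

lemma finite_line: "finite (line l)"
proof -
  have "line l \<subseteq> {snd l * c..<snd l * c + (m * c + s)}" using line_bounds[of _ l] by auto
  thus ?thesis using finite_subset by blast
qed

lemma lo_eq: "lo x = c * (x div c - m + (if x mod c < s then 0 else 1))"
proof -
  have x: "x - (m * c + s) = (x div c - m) * c + (x mod c - s)"
    using div_mult_mod_eq[of x c] by (simp add: algebra_simps)
  have b: "0 \<le> x mod c" "x mod c < c" using c_pos by auto
  have "(x - (m * c + s)) div c = x div c - m + (x mod c - s) div c"
    unfolding x using c_pos by simp
  moreover have "(x mod c - s) div c = (if x mod c < s then - 1 else 0)"
  proof (cases "x mod c < s")
    case True
    have "(x mod c - s) div c = - 1"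
      using b s_less True by (intro int_div_pos_eq[of _ _ _ "x mod c - s + c"]) linarith+
    thus ?thesis using True by simp
  next
    case False
    thus ?thesis using b s_nonneg by (auto simp: div_pos_pos_trivial)
  qed
  ultimately show ?thesis unfolding lo_def by simp
qed

lemma lo_le_line: "x \<in> line l \<Longrightarrow> y \<in> line l \<Longrightarrow> lo x \<le> y"
proof -
  assume xy: "x \<in> line l" "y \<in> line l"
  have "x - (m * c + s) < snd l * c" using line_bounds[OF xy(1)] by simp
  moreover have "(x - (m * c + s)) div c * c \<le> x - (m * c + s)"
    using div_mult_mod_eq[of "x - (m * c + s)" c] pos_mod_sign[OF c_pos, of "x - (m * c + s)"] by linarith
  ultimately have "(x - (m * c + s)) div c * c < snd l * c" by linarith
  hence "(x - (m * c + s)) div c < snd l" using c_pos by simp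
  hence "lo x \<le> c * snd l" unfolding lo_def using c_pos by (intro mult_left_mono) auto
  thus ?thesis using line_bounds[OF xy(2)] by (simp add: mult.commute)
qed

lemma line_less_hi: "x \<in> line l \<Longrightarrow> y \<in> line l \<Longrightarrow> y < hi x"
proof -
  assume xy: "x \<in> line l" "y \<in> line l"
  have "snd l = (snd l * c) div c" using c_pos by simp
  also have "\<dots> \<le> x div c" using line_bounds[OF xy(1)] c_pos by (intro zdiv_mono1) auto
  finally have "c * snd l \<le> c * (x div c)" using c_pos by simp
  thus ?thesis unfolding hi_def using line_bounds[OF xy(2)] by (simp add: mult.commute)
qed

lemma lo_mono: "x \<le> y \<Longrightarrow> lo x \<le> lo y"
  unfolding lo_def using c_pos zdiv_mono1[of "x - (m * c + s)" "y - (m * c + s)" c] by simp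

lemma hi_mono: "x \<le> y \<Longrightarrow> hi x \<le> hi y"
  unfolding hi_def using c_pos zdiv_mono1[of x y c] by simp

definition nbr :: "int \<Rightarrow> int set" where "nbr x = {y. adj x y}"

lemma nbr_subset: "nbr x \<subseteq> {lo x..<hi x}"
  unfolding nbr_def adj_def using lo_le_line line_less_hi by auto

lemma finite_nbr: "finite (nbr x)"
  using nbr_subset finite_subset by blast

text \<open>Otherwise the lines joining \<open>z\<close> to \<open>x\<close> and to \<open>y\<close>
  either form a triangle with \<open>l\<close>, or coincide and meet \<open>l\<close> in two
  points.\<close>

lemma adj_common_nbr:
  assumes "adj x z" "adj y z" "x \<in> line l" "y \<in> line l" "x \<noteq> y"
  shows "z \<in> line l"
proof (rule ccontr)
  assume z: "z \<notin> line l"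
  obtain l1 l2 where l: "x \<in> line l1" "z \<in> line l1" "y \<in> line l2" "z \<in> line l2" "x \<noteq> z" "y \<noteq> z"
    using assms unfolding adj_def by auto
  have ne: "l1 \<noteq> l" "l2 \<noteq> l" using l z by auto
  show False
  proof (cases "l1 = l2")
    case True
    thus False using two_lines[OF ne(1), of x y] l assms by auto
  next
    case False
    show False
      using three_lines[of l l1 l2 x z y] ne False l assms by auto
  qed
qed

text \<open>With \<open>y = x + j * c\<close> and \<open>z = y + k * c\<close>, three translates of
  one line form a triangle on \<open>x\<close>, \<open>u = x + k * c\<close> and \<open>z\<close>:
  \<open>l\<close> itself joins \<open>x\<close> and \<open>z\<close>, its translate by
  \<open>- j * c\<close> joins \<open>x\<close> and \<open>u\<close>, and its translate by
  \<open>k * c\<close> joins \<open>u\<close> and \<open>z\<close>.\<close>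

lemma class_at_most_twice:
  assumes "x \<in> line l" "y \<in> line l" "z \<in> line l" "x < y" "y < z" "x mod c = y mod c" "y mod c = z mod c"
  shows False
proof -
  obtain j where j: "y = x + j * c" using assms(6) by (metis mod_eq_dvd_iff dvd_def diff_eq_eq add.commute mult.commute)
  obtain k where k: "z = y + k * c" using assms(7) by (metis mod_eq_dvd_iff dvd_def diff_eq_eq add.commute mult.commute)
  have jk: "j > 0" "k > 0" using assms(4,5) c_pos unfolding j k by (auto simp: zero_less_mult_iff)
  obtain i t where l: "l = (i, t)" by (cases l)
  define u where "u = x + k * c"
  have 1: "x \<in> line (i, t - j)" using assms(2) line_shift[of x j i "t - j"] unfolding l j by simp
  have 2: "u \<in> line (i, t - j)" using assms(3) line_shift[of u j i "t - j"] unfolding l j k u_def by (simp add: algebra_simps)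
  have 3: "u \<in> line (i, t + k)" using assms(1) line_shift[of x k i t] unfolding l u_def by simp
  have 4: "z \<in> line (i, t + k)" using assms(2) line_shift[of y k i t] unfolding l k by simp
  have "0 < j * c" "0 < k * c" using jk c_pos by simp_all
  hence ne: "x \<noteq> u" "z \<noteq> u" "x \<noteq> z" unfolding u_def k j by linarith+
  show False
    using three_lines[of "(i, t)" "(i, t - j)" "(i, t + k)" x u z] jk ne 1 2 3 4 assms(1,3) unfolding l by auto
qed

text \<open>The line and its translate by \<open>k * c\<close> share the two points
  \<open>x + k * c\<close> and \<open>y + k * c\<close>.\<close>

lemma equal_gaps:
  assumes "x \<in> line l" "x + k * c \<in> line l" "y \<in> line l" "y + k * c \<in> line l" "k \<noteq> 0"
  shows "x = y"
proof -
  obtain i t where l: "l = (i, t)" by (cases l)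
  show ?thesis
    using two_lines[of "(i, t)" "(i, t + k)" "x + k * c" "y + k * c"] assms line_shift[of x k i t] line_shift[of y k i t]
    unfolding l by simp
qed

end

section \<open>Weighted degrees\<close>

locale weighted_lines = shifted_lines I A c m s
  for I :: "'i set" and A :: "'i \<Rightarrow> int set" and c m s :: int +
  fixes p :: "int \<Rightarrow> real"
  assumes p_shift: "p (x + c) = p x" and p_nonneg: "0 \<le> p x"
begin

definition T :: real where "T = sum p {0..<c}"
definition Ts :: real where "Ts = sum p {0..<s}"
definition deg :: "int \<Rightarrow> real" where "deg x = sum p (nbr x)"
definition rdeg :: "int \<Rightarrow> real" where "rdeg x = sum p {y \<in> nbr x. x < y}"
definition ldeg :: "int \<Rightarrow> real" where "ldeg x = sum p {y \<in> nbr x. y < x}"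
\<comment> \<open>half the gradient of \<open>m * T\<^sup>2 + Ts * T\<close>, which equals \<open>c * (m * c + s)\<close> for weights 1\<close>
definition V :: "int \<Rightarrow> real" where
  "V x = m * T + Ts / 2 + (if x mod c < s then T / 2 else 0)"
definition K :: "'i \<times> int \<Rightarrow> int set" where "K l = {x \<in> line l. 0 < p x}"

lemma p_add: "p (x + k * c) = p x"
proof (induction k rule: int_induct[of _ 0])
  case (step1 i)
  thus ?case using p_shift[of "x + i * c"] by (simp add: algebra_simps)
next
  case (step2 i)
  thus ?case using p_shift[of "x + (i - 1) * c"] by (simp add: algebra_simps)
qed simp

lemma p_mod: "p (x mod c) = p x"
  using p_add[of "x mod c" "x div c"] by (simp add: add.commute)

lemma T_nonneg: "0 \<le> T" and Ts_nonneg: "0 \<le> Ts" and Ts_le_T: "Ts \<le> T"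
  unfolding T_def Ts_def using s_less by (auto intro!: sum_nonneg sum_mono2 p_nonneg)

lemma sum_shift: "sum p {a + k * c..<b + k * c} = sum p {a..<b}"
proof (rule sum.reindex_bij_witness[of _ "\<lambda>x. x + k * c" "\<lambda>x. x - k * c"])
  show "p (x - k * c) = p x" for x using p_add[of "x - k * c" k] by simp
qed auto

lemma sum_blocks:
  assumes "a \<le> b"
  shows "sum p {c * a..<c * b} = (b - a) * T"
  using assms
proof (induction b rule: int_ge_induct)
  case (step b)
  have un: "{c * a..<c * (b + 1)} = {c * a..<c * b} \<union> {c * b..<c * (b + 1)}"
    using step c_pos by (intro ivl_disj_un_two(3)[symmetric]) auto
  have "sum p {c * b..<c * (b + 1)} = T"
    using sum_shift[of 0 b c] unfolding T_def by (simp add: algebra_simps)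
  thus ?case unfolding un using step by (subst sum.union_disjoint) (auto simp: algebra_simps)
qed simp

text \<open>The interval starts at a block boundary and ends \<open>s\<close> places into a block,
  so it consists of whole blocks of weight \<open>T\<close> and a remainder of weight
  \<open>Ts\<close>.\<close>

lemma sum_reach:
  assumes "x div c \<le> z div c"
  shows "sum p {lo x..<hi z} =
    (z div c - x div c + (if x mod c < s then 1 else 0) + 2 * m - 1) * T + Ts"
proof -
  define b where "b = x div c - m + (if x mod c < s then 0 else 1)"
  have lo: "lo x = c * b" unfolding lo_eq b_def ..
  have b: "b \<le> z div c + m" using assms m_ge unfolding b_def by auto
  have hi: "hi z = c * (z div c + m) + s" unfolding hi_def by (simp add: algebra_simps)
  have "{lo x..<hi z} = {c * b..<c * (z div c + m)} \<union> {c * (z div c + m)..<c * (z div c + m) + s}"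
    unfolding lo hi using b c_pos s_nonneg by (intro ivl_disj_un_two(3)[symmetric]) auto
  moreover have "sum p {c * (z div c + m)..<c * (z div c + m) + s} = Ts"
    using sum_shift[of 0 "z div c + m" s] unfolding Ts_def by (simp add: algebra_simps)
  ultimately have "sum p {lo x..<hi z} = (z div c + m - b) * T + Ts"
    using sum_blocks[OF b] by (subst \<open>{lo x..<hi z} = _\<close>, subst sum.union_disjoint) auto
  thus ?thesis unfolding b_def by (auto simp: algebra_simps)
qed

lemma sum_left_reach:
  "sum p {lo x..x} = (m - (if x mod c < s then 0 else 1)) * T + sum p {0..x mod c}"
proof -
  define b where "b = x div c - m + (if x mod c < s then 0 else 1)"
  have lo: "lo x = c * b" unfolding lo_eq b_def ..
  have b: "b \<le> x div c" using m_ge unfolding b_def by auto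
  have x: "x = c * (x div c) + x mod c" by simp
  have "0 \<le> x mod c" using c_pos by simp
  hence "c * (x div c) \<le> x" using x by linarith
  hence "{lo x..x} = {c * b..<c * (x div c)} \<union> {c * (x div c)..<x + 1}"
    unfolding lo using b c_pos by (subst ivl_disj_un_two(3)) auto
  moreover have "sum p {c * (x div c)..<x + 1} = sum p {0..x mod c}"
    using sum_shift[of 0 "x div c" "x mod c + 1"] x
    by (simp add: ac_simps flip: atLeastLessThanPlusOne_atLeastAtMost_int)
  ultimately have "sum p {lo x..x} = (x div c - b) * T + sum p {0..x mod c}"
    using sum_blocks[OF b] by (subst \<open>{lo x..x} = _\<close>, subst sum.union_disjoint) auto
  thus ?thesis unfolding b_def by (auto simp: algebra_simps)
qed

text \<open>Below offset \<open>s\<close> this uses \<open>Ts \<le> T\<close>. Together with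
  \<open>farthest_right_nbr\<close> it turns a degree above \<open>V v\<close> into a right degree
  of \<open>v\<close> above that of \<open>u\<close>.\<close>

lemma sum_left_reach_le_V: "sum p {lo x..x} \<le> V x"
proof (cases "x mod c < s")
  case True
  have "sum p {0..x mod c} \<le> Ts" unfolding Ts_def using True
    by (intro sum_mono2) (auto intro: p_nonneg)
  thus ?thesis using True Ts_le_T unfolding sum_left_reach V_def by simp
next
  case False
  have "sum p {0..x mod c} \<le> T" unfolding T_def using pos_mod_bound[OF c_pos, of x]
    by (intro sum_mono2) (auto intro: p_nonneg)
  thus ?thesis using False Ts_nonneg unfolding sum_left_reach V_def by (simp add: algebra_simps)
qed

lemma V_nonneg: "0 \<le> V x"
  unfolding V_def using T_nonneg Ts_nonneg m_ge by auto

lemma deg_split: "deg x = ldeg x + rdeg x"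
proof -
  have "nbr x = {y \<in> nbr x. y < x} \<union> {y \<in> nbr x. x < y}" unfolding nbr_def adj_def by auto
  hence "deg x = sum p ({y \<in> nbr x. y < x} \<union> {y \<in> nbr x. x < y})" unfolding deg_def by metis
  also have "\<dots> = ldeg x + rdeg x" unfolding ldeg_def rdeg_def
    by (intro sum.union_disjoint) (auto simp: finite_nbr)
  finally show ?thesis .
qed

lemma rdeg_shift: "rdeg (x + k * c) = rdeg x"
  unfolding rdeg_def
proof (rule sum.reindex_bij_witness[of _ "\<lambda>y. y + k * c" "\<lambda>y. y - k * c"])
  fix y assume "y \<in> {y \<in> nbr (x + k * c). x + k * c < y}"
  thus "y - k * c \<in> {y \<in> nbr x. x < y}" "p (y - k * c) = p y"
    using adj_shift[of x k "y - k * c"] p_add[of "y - k * c" k] by (auto simp: nbr_def)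
next
  fix y assume "y \<in> {y \<in> nbr x. x < y}"
  thus "y + k * c \<in> {y \<in> nbr (x + k * c). x + k * c < y}"
    using adj_shift[of x k y] by (auto simp: nbr_def)
qed auto

lemma finite_K: "finite (K l)"
  unfolding K_def using finite_line by simp

lemma finite_rdeg_values: "finite (rdeg ` S)"
proof -
  have "rdeg x = rdeg (x mod c)" for x
    using rdeg_shift[of "x mod c" "x div c"] by (simp add: add.commute)
  moreover have "x mod c \<in> {0..<c}" for x using c_pos by simp
  ultimately have "rdeg ` S \<subseteq> rdeg ` {0..<c}" by blast
  thus ?thesis using finite_surj by blast
qed

text \<open>Right degrees are periodic, so they take finitely many values even on an infinite
  support.\<close>

lemma max_rdeg_exists:
  assumes "0 < p x"
  obtains u where "0 < p u" "\<And>v. 0 < p v \<Longrightarrow> rdeg v \<le> rdeg u"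
proof -
  let ?S = "{x. 0 < p x}"
  have "Max (rdeg ` ?S) \<in> rdeg ` ?S" using assms finite_rdeg_values by (intro Max_in) auto
  then obtain u where u: "0 < p u" "rdeg u = Max (rdeg ` ?S)" by auto
  thus ?thesis using that[of u] finite_rdeg_values[of ?S] by (auto intro: Max_ge)
qed

text \<open>If no line carries three points of the support, then a point \<open>u\<close> and its farthest right
  neighbour \<open>v\<close> have no common neighbour between them in the support, so that the right neighbours
  of \<open>u\<close> and the left neighbours of \<open>v\<close> fit disjointly into \<open>{lo v..v}\<close>.\<close>

lemma farthest_right_nbr:
  assumes K2: "\<And>l. card (K l) \<le> 2" and u: "0 < p u" "0 < rdeg u"
  obtains v where "adj u v" "0 < p v" "rdeg u + ldeg v \<le> sum p {lo v..v}"
proof -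
  define R where "R = {y \<in> nbr u. u < y \<and> 0 < p y}"
  have fR: "finite R" unfolding R_def using finite_nbr by simp
  have rR: "rdeg u = sum p R" unfolding rdeg_def R_def
    using finite_nbr p_nonneg by (intro sum.mono_neutral_right) (auto simp: less_eq_real_def)
  hence ne: "R \<noteq> {}" using u by auto
  define v where "v = Max R"
  have v: "v \<in> R" unfolding v_def using fR ne by simp
  hence uv: "adj u v" "u < v" "0 < p v" unfolding R_def nbr_def by auto
  define N where "N = {y \<in> nbr v. y < v \<and> 0 < p y}"
  have fN: "finite N" unfolding N_def using finite_nbr by simp
  have lN: "ldeg v = sum p N" unfolding ldeg_def N_def
    using finite_nbr p_nonneg by (intro sum.mono_neutral_right) (auto simp: less_eq_real_def)
  have disj: "R \<inter> N = {}"
  proof (rule ccontr)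
    assume "R \<inter> N \<noteq> {}"
    then obtain z where z: "adj u z" "u < z" "0 < p z" "adj v z" "z < v"
      unfolding R_def N_def nbr_def by auto
    obtain l where l: "u \<in> line l" "v \<in> line l" using uv unfolding adj_def by auto
    have "z \<in> line l" using adj_common_nbr[of u z v l] z l uv by auto
    hence "{u, z, v} \<subseteq> K l" unfolding K_def using l u uv z by auto
    hence "card {u, z, v} \<le> card (K l)" using finite_K card_mono by blast
    thus False using K2[of l] z uv by simp
  qed
  have "nbr v \<subseteq> {lo v..<hi v}" by (rule nbr_subset)
  moreover have "u \<in> nbr v" using uv adj_sym unfolding nbr_def by auto
  ultimately have lou: "lo v \<le> u" by auto
  have "R \<union> N \<subseteq> {lo v..v}"
  proof
    fix y assume y: "y \<in> R \<union> N"
    have "y \<in> R \<Longrightarrow> y \<le> v" unfolding v_def using fR by simp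
    thus "y \<in> {lo v..v}" using y lou nbr_subset[of v] unfolding R_def N_def by auto
  qed
  hence "sum p (R \<union> N) \<le> sum p {lo v..v}" by (intro sum_mono2) (auto intro: p_nonneg)
  hence "rdeg u + ldeg v \<le> sum p {lo v..v}"
    unfolding rR lN using fR fN disj by (simp add: sum.union_disjoint)
  thus ?thesis using that uv by blast
qed

text \<open>Of two adjacent points of the support, the left one has positive right degree.\<close>

lemma no_right_nbrs:
  assumes "\<And>y. 0 < p y \<Longrightarrow> rdeg y \<le> 0" "0 < p x"
  shows "deg x = 0"
proof -
  have "p y = 0" if y: "y \<in> nbr x" for y
  proof (rule ccontr)
    assume "p y \<noteq> 0"
    hence py: "0 < p y" using p_nonneg[of y] by simp
    have pos: "0 < rdeg a" if "adj a b" "a < b" "0 < p b" for a b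
      using that finite_nbr[of a] unfolding rdeg_def nbr_def
      by (intro sum_pos2[of _ b]) (auto intro: p_nonneg simp: nbr_def)
    have "x < y \<or> y < x" using y unfolding nbr_def adj_def by auto
    thus False using pos[of x y] pos[of y x] y py assms adj_sym unfolding nbr_def by fastforce
  qed
  thus ?thesis unfolding deg_def by simp
qed

text \<open>For \<open>u\<close> of maximal right degree and its farthest right neighbour
  \<open>v\<close>, \<open>rdeg u + ldeg v \<le> V v < deg v = ldeg v + rdeg v\<close>,
  contradicting maximality.\<close>

lemma deg_exceeds_V_False:
  assumes K2: "\<And>l. card (K l) \<le> 2" and x: "0 < p x" and \<eta>: "0 < \<eta>"
    and deg: "\<And>x. 0 < p x \<Longrightarrow> V x + \<eta> \<le> deg x"
  shows False
proof -
  obtain u where u: "0 < p u" "\<And>v. 0 < p v \<Longrightarrow> rdeg v \<le> rdeg u"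
    using max_rdeg_exists[OF x] by blast
  show False
  proof (cases "0 < rdeg u")
    case True
    obtain v where v: "adj u v" "0 < p v" "rdeg u + ldeg v \<le> sum p {lo v..v}"
      using farthest_right_nbr[OF K2 u(1) True] by blast
    show False using v u(2)[OF v(2)] deg[OF v(2)] deg_split[of v] sum_left_reach_le_V[of v] \<eta> by linarith
  next
    case False
    hence "deg x = 0" using no_right_nbrs[of x] u(2) x by fastforce
    thus False using deg[OF x] V_nonneg[of x] \<eta> by linarith
  qed
qed

text \<open>Points outside a line have at most one neighbour on it, so the outer neighbourhoods of the points of
  \<open>K l\<close> are disjoint.\<close>

lemma sum_deg_K_le:
  assumes ne: "K l \<noteq> {}"
  shows "(\<Sum>x\<in>K l. deg x) \<le> (real (card (K l)) - 2) * sum p (K l) + sum p {lo (Min (K l))..<hi (Max (K l))}"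
proof -
  define W where "W x = nbr x - line l" for x
  have deg: "deg x = sum p (K l) - p x + sum p (W x)" if x: "x \<in> K l" for x
  proof -
    have xl: "x \<in> line l" using x unfolding K_def by simp
    have "nbr x = (line l - {x}) \<union> W x" using xl unfolding W_def nbr_def adj_def by blast
    hence "deg x = sum p ((line l - {x}) \<union> W x)" unfolding deg_def by metis
    also have "\<dots> = sum p (line l - {x}) + sum p (W x)"
      by (intro sum.union_disjoint) (auto simp: W_def finite_line finite_nbr)
    finally have "deg x = sum p (line l - {x}) + sum p (W x)" .
    moreover have "sum p (line l - {x}) = sum p (line l) - p x"
      using finite_line xl by (simp add: sum_diff1)
    moreover have "sum p (line l) = sum p (K l)" unfolding K_def
      using finite_line p_nonneg by (intro sum.mono_neutral_right) (auto simp: less_eq_real_def)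
    ultimately show ?thesis by simp
  qed
  have disj: "W x \<inter> W y = {}" if "x \<in> K l" "y \<in> K l" "x \<noteq> y" for x y
    using adj_common_nbr[of x _ y l] that unfolding W_def K_def nbr_def by blast
  \<comment> \<open>The outer neighbourhoods also avoid \<open>K l\<close> itself; subtracting its
    weight once more turns the factor \<open>card (K l) - 1\<close> into
    \<open>card (K l) - 2\<close>.\<close>
  have "(\<Union>x\<in>K l. W x) \<subseteq> {lo (Min (K l))..<hi (Max (K l))} - K l"
  proof
    fix y assume "y \<in> (\<Union>x\<in>K l. W x)"
    then obtain x where x: "x \<in> K l" "y \<in> W x" by auto
    have "lo (Min (K l)) \<le> lo x" "hi x \<le> hi (Max (K l))"
      using x finite_K lo_mono hi_mono by auto
    moreover have "y \<in> {lo x..<hi x}" using x nbr_subset[of x] unfolding W_def by auto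
    ultimately show "y \<in> {lo (Min (K l))..<hi (Max (K l))} - K l"
      using x unfolding W_def K_def by auto
  qed
  hence "sum p (\<Union>x\<in>K l. W x) \<le> sum p ({lo (Min (K l))..<hi (Max (K l))} - K l)"
    by (intro sum_mono2) (auto intro: p_nonneg)
  also have "\<dots> = sum p {lo (Min (K l))..<hi (Max (K l))} - sum p (K l)"
  proof (intro sum_diff)
    have mem: "Min (K l) \<in> line l" "Max (K l) \<in> line l"
      using Min_in[OF finite_K ne] Max_in[OF finite_K ne] unfolding K_def by auto
    show "K l \<subseteq> {lo (Min (K l))..<hi (Max (K l))}"
      using lo_le_line[OF mem(1)] line_less_hi[OF mem(2)] unfolding K_def by auto
  qed auto
  finally have "(\<Sum>x\<in>K l. sum p (W x)) \<le> sum p {lo (Min (K l))..<hi (Max (K l))} - sum p (K l)"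
    using disj finite_K finite_nbr by (subst (asm) sum.UNION_disjoint) (auto simp: W_def)
  moreover have "(\<Sum>x\<in>K l. deg x) = (\<Sum>x\<in>K l. sum p (K l) - p x + sum p (W x))"
    using deg by (intro sum.cong) auto
  ultimately show ?thesis by (simp add: sum.distrib sum_subtractf algebra_simps)
qed

text \<open>The witness \<open>k\<close> is the difference between the block indices \<open>x div c\<close> of the last and the first point
  of \<open>K l\<close>, plus one if the first point has offset below \<open>s\<close>.\<close>

lemma excess_K_le:
  assumes ne: "K l \<noteq> {}"
  defines "i \<equiv> card {x \<in> K l. x mod c < s}" and "w \<equiv> card (K l)"
  obtains k :: int where "k \<le> m + 1" "2 * k \<le> 2 * m + i" "i \<noteq> 2 \<Longrightarrow> 2 * k \<le> 2 * m + i - 1"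
    "(\<Sum>x\<in>K l. deg x - V x) \<le> (real w - 2) * sum p (K l) + (k + 2 * m - 1 - w * m - i / 2) * T - (w / 2 - 1) * Ts"
proof -
  define a z where "a = Min (K l)" and "z = Max (K l)"
  have az: "a \<in> K l" "z \<in> K l" "a \<le> z" unfolding a_def z_def using finite_K ne by auto
  define k where "k = z div c - a div c + (if a mod c < s then 1 else 0)"
  let ?J = "{x \<in> K l. x mod c < s}"
  have fJ: "finite ?J" using finite_K by simp
  define t where "t = snd l"
  have bds: "t \<le> x div c" "x div c \<le> t + m" "x div c = t + m \<Longrightarrow> x mod c < s" if "x \<in> K l" for x
    using line_block_bounds[of x l] that unfolding K_def t_def by auto
  have k1: "k \<le> m + 1" unfolding k_def using bds[OF az(1)] bds[OF az(2)] by auto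
  \<comment> \<open>Large spreads need low offsets: \<open>k = m\<close> forces \<open>a\<close> or
    \<open>z\<close> to have offset below \<open>s\<close>, and \<open>k = m + 1\<close> forces
    both, with \<open>a\<close> and \<open>z\<close> distinct.\<close>
  have i1: "1 \<le> i" if "k \<ge> m"
  proof -
    have "a mod c < s \<or> z div c = t + m"
      using that bds[OF az(1)] bds[OF az(2)] unfolding k_def by (auto split: if_splits)
    hence "?J \<noteq> {}" using az bds[OF az(2)] by auto
    thus ?thesis unfolding i_def using fJ by (simp add: Suc_le_eq card_gt_0_iff)
  qed
  have i2: "2 \<le> i" if "k \<ge> m + 1"
  proof -
    have *: "a mod c < s" "z div c = t + m" "a div c = t"
      using that bds[OF az(1)] bds[OF az(2)] unfolding k_def by (auto split: if_splits)
    hence "a \<noteq> z" using m_ge by auto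
    moreover have "{a, z} \<subseteq> ?J" using * az bds[OF az(2)] by auto
    ultimately show ?thesis unfolding i_def using card_mono[OF fJ, of "{a, z}"] by simp
  qed
  \<comment> \<open>Equality in the first bound occurs only for \<open>k = m + 1\<close> and
    \<open>i = 2\<close>.\<close>
  have kbd: "2 * k \<le> 2 * m + i" "i \<noteq> 2 \<Longrightarrow> 2 * k \<le> 2 * m + i - 1"
  proof -
    have "k \<le> m - 1 \<or> k = m \<or> k = m + 1" using k1 by linarith
    thus "2 * k \<le> 2 * m + i" using i1 i2 by (elim disjE) linarith+
    show "2 * k \<le> 2 * m + i - 1" if "i \<noteq> 2"
      using \<open>k \<le> m - 1 \<or> k = m \<or> k = m + 1\<close> i1 i2 that by (elim disjE) linarith+
  qed
  have "(\<Sum>x\<in>K l. V x) = w * (m * T + Ts / 2) + (\<Sum>x\<in>K l. if x mod c < s then T / 2 else 0)"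
    unfolding V_def w_def by (simp add: sum.distrib)
  also have "(\<Sum>x\<in>K l. if x mod c < s then T / 2 else 0) = i * (T / 2)"
    unfolding i_def using finite_K by (simp add: sum.If_cases Int_def)
  finally have V: "(\<Sum>x\<in>K l. V x) = w * (m * T + Ts / 2) + i * (T / 2)" .
  have "a div c \<le> z div c" using az(3) c_pos by (intro zdiv_mono1)
  hence reach: "sum p {lo a..<hi z} = (k + 2 * m - 1) * T + Ts" unfolding k_def by (subst sum_reach) auto
  have ex: "(\<Sum>x\<in>K l. deg x - V x) \<le> (real w - 2) * sum p (K l) + (k + 2 * m - 1 - w * m - i / 2) * T - (w / 2 - 1) * Ts"
    using sum_deg_K_le[OF ne] V reach unfolding sum_subtractf a_def[symmetric] z_def[symmetric] w_def[symmetric]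
    by (simp add: algebra_simps)
  show ?thesis by (rule that[OF k1 kbd(1) kbd(2) ex])
qed

end

section \<open>Multiplicities of residue classes on a line, and windows of at least two
  periods\<close>

context weighted_lines
begin

definition mult :: "'i \<times> int \<Rightarrow> int \<Rightarrow> nat" where
  "mult l r = card {x \<in> K l. x mod c = r}"

lemma deg_shift: "deg (x + k * c) = deg x"
  unfolding deg_def
proof (rule sum.reindex_bij_witness[of _ "\<lambda>y. y + k * c" "\<lambda>y. y - k * c"])
  fix y assume "y \<in> nbr (x + k * c)"
  thus "y - k * c \<in> nbr x" "p (y - k * c) = p y"
    using adj_shift[of x k "y - k * c"] p_add[of "y - k * c" k] by (auto simp: nbr_def)
next
  fix y assume "y \<in> nbr x"
  thus "y + k * c \<in> nbr (x + k * c)" using adj_shift[of x k y] by (auto simp: nbr_def)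
qed auto

lemma deg_mod: "deg (x mod c) = deg x"
  using deg_shift[of "x mod c" "x div c"] by (simp add: add.commute)

lemma V_mod: "V (x mod c) = V x"
  unfolding V_def by simp

lemma sum_K_by_class:
  fixes f :: "int \<Rightarrow> real"
  assumes "\<And>x. f (x mod c) = f x"
  shows "(\<Sum>x\<in>K l. f x) = (\<Sum>r\<in>{0..<c}. mult l r * f r)"
proof -
  have "(\<Sum>x\<in>K l. f x) = (\<Sum>r\<in>{0..<c}. \<Sum>x\<in>{x \<in> K l. x mod c = r}. f x)"
    using finite_K c_pos by (intro sum.group[symmetric]) auto
  also have "\<dots> = (\<Sum>r\<in>{0..<c}. \<Sum>x\<in>{x \<in> K l. x mod c = r}. f r)"
    using assms by (intro sum.cong refl) (metis (mono_tags, lifting) mem_Collect_eq)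
  finally show ?thesis unfolding mult_def by simp
qed

lemma mult_pos: "0 < mult l r \<Longrightarrow> 0 < p r"
proof -
  assume "0 < mult l r"
  hence "{x \<in> K l. x mod c = r} \<noteq> {}" unfolding mult_def using card_gt_0_iff by blast
  thus "0 < p r" using p_mod unfolding K_def by force
qed

lemma mult_le_2: "mult l r \<le> 2"
proof (rule ccontr)
  assume "\<not> ?thesis"
  hence c3: "3 \<le> card {x \<in> K l. x mod c = r}" unfolding mult_def by simp
  obtain S where S: "S \<subseteq> {x \<in> K l. x mod c = r}" "card S = 3" "finite S"
    using obtain_subset_with_card_n[OF c3] .
  define x z where "x = Min S" and "z = Max S"
  have ne: "S \<noteq> {}" using S by auto
  have xz: "x \<in> S" "z \<in> S" unfolding x_def z_def using S(3) ne by auto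
  have "\<not> S \<subseteq> {x, z}"
  proof
    assume "S \<subseteq> {x, z}"
    hence "card S \<le> card {x, z}" by (intro card_mono) auto
    also have "\<dots> \<le> 2" by (simp add: card_insert_if)
    finally show False using S(2) by simp
  qed
  then obtain y where y: "y \<in> S" "y \<noteq> x" "y \<noteq> z" by blast
  have "x \<le> y" "y \<le> z" unfolding x_def z_def using y S(3) by auto
  hence "x < y" "y < z" using y by auto
  moreover have "x \<in> line l" "y \<in> line l" "z \<in> line l" "x mod c = r" "y mod c = r" "z mod c = r"
    using xz y S(1) unfolding K_def by blast+
  ultimately show False using class_at_most_twice by metis
qed

lemma mult_2_obtain:
  assumes "mult l r = 2"
  obtains x y where "x \<in> K l" "y \<in> K l" "x < y" "x mod c = r" "y mod c = r" "{x \<in> K l. x mod c = r} = {x, y}"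
proof -
  obtain x y where xy: "x \<noteq> y" "{x \<in> K l. x mod c = r} = {x, y}"
    using assms unfolding mult_def by (meson card_2_iff)
  have "x \<in> K l \<and> y \<in> K l \<and> x mod c = r \<and> y mod c = r" using xy(2) by blast
  thus ?thesis using xy that[of x y] that[of y x] by (cases "x < y") (auto simp: insert_commute)
qed

lemma card_K_eq: "card (K l) = (\<Sum>r\<in>{0..<c}. mult l r)"
proof -
  have "real (card (K l)) = (\<Sum>r\<in>{0..<c}. real (mult l r))"
    using sum_K_by_class[of "\<lambda>_. 1" l] by simp
  thus ?thesis by (metis of_nat_eq_iff of_nat_sum)
qed

lemma sum_p_K: "sum p (K l) = (\<Sum>r\<in>{0..<c}. mult l r * p r)"
  by (rule sum_K_by_class) (rule p_mod)

lemma sum_p_K_le: "sum p (K l) \<le> 2 * T"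
  unfolding sum_p_K T_def sum_distrib_left
  using mult_le_2 p_nonneg by (intro sum_mono mult_right_mono) auto

lemma p_le_Ts: "0 \<le> r \<Longrightarrow> r < s \<Longrightarrow> p r \<le> Ts"
  unfolding Ts_def by (intro member_le_sum) (auto intro: p_nonneg)

lemma Ts_alt: "Ts = (\<Sum>r\<in>{0..<c}. if r < s then p r else 0)"
  unfolding Ts_def using s_less by (intro sum.mono_neutral_cong_left) auto

lemma mult_le_card_low: "r \<in> {0..<c} \<Longrightarrow> r < s \<Longrightarrow> mult l r \<le> card {x \<in> K l. x mod c < s}"
  unfolding mult_def using finite_K by (intro card_mono) auto

lemma card_low_le: "r \<in> {0..<c} \<Longrightarrow> \<not> r < s \<Longrightarrow> mult l r + card {x \<in> K l. x mod c < s} \<le> card (K l)"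
proof -
  assume r: "r \<in> {0..<c}" "\<not> r < s"
  have "mult l r + card {x \<in> K l. x mod c < s} = card ({x \<in> K l. x mod c = r} \<union> {x \<in> K l. x mod c < s})"
    unfolding mult_def using finite_K r by (subst card_Un_disjoint) auto
  also have "\<dots> \<le> card (K l)" using finite_K by (intro card_mono) auto
  finally show ?thesis .
qed

text \<open>The assumptions are the optimality conditions at a maximum over the unit cube: the gradient is
  nonnegative on the support and can be positive only where the weight is 1.\<close>

context
  fixes \<eta> :: real
  assumes \<eta>: "0 < \<eta>" and p_le_1: "\<And>x. p x \<le> 1"
    and deg_ge: "\<And>x. 0 < p x \<Longrightarrow> V x + \<eta> \<le> deg x"
    and capped: "3 / 4 \<le> (\<Sum>r\<in>{r\<in>{0..<c}. p r = 1}. deg r - V r - \<eta>)"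
begin

text \<open>Every class of the support contributes nonnegatively, so a line carrying each class of
  weight 1 at least \<open>n\<close> times collects at least \<open>n\<close> times the sum in
  \<open>capped\<close>. The inequality is strict because each point of \<open>K l\<close> adds a
  further \<open>\<eta>\<close>.\<close>

lemma capped_subset_K_sum:
  assumes sub: "\<And>r. r \<in> {0..<c} \<Longrightarrow> p r = 1 \<Longrightarrow> n \<le> mult l r" and K3: "3 \<le> card (K l)"
  shows "n * (3 / 4) < (\<Sum>x\<in>K l. deg x - V x)"
proof -
  define G where "G r = deg r - V r - \<eta>" for r
  have G: "0 \<le> G r" if "0 < p r" for r using deg_ge[OF that] unfolding G_def by simp
  have "n * (3 / 4) \<le> (\<Sum>r\<in>{r\<in>{0..<c}. p r = 1}. n * G r)"
    using mult_left_mono[OF capped, of n] unfolding G_def sum_distrib_left by simp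
  also have "\<dots> \<le> (\<Sum>r\<in>{r\<in>{0..<c}. p r = 1}. mult l r * G r)"
    using sub G by (intro sum_mono mult_right_mono) auto
  also have "\<dots> \<le> (\<Sum>r\<in>{0..<c}. mult l r * G r)"
  proof (rule sum_mono2)
    show "0 \<le> mult l r * G r" for r
      using mult_pos[of l r] G[of r] by (cases "mult l r = 0") auto
  qed auto
  also have "\<dots> = (\<Sum>x\<in>K l. G x)"
    by (rule sum_K_by_class[symmetric]) (simp add: G_def deg_mod V_mod)
  also have "\<dots> = (\<Sum>x\<in>K l. deg x - V x) - card (K l) * \<eta>"
    unfolding G_def by (simp add: sum_subtractf)
  also have "\<dots> < (\<Sum>x\<in>K l. deg x - V x)" using K3 \<eta> by simp
  finally show ?thesis .
qed

lemma sum_excess_pos: "3 \<le> card (K l) \<Longrightarrow> 0 < (\<Sum>x\<in>K l. deg x - V x)"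
  using capped_subset_K_sum[of 0 l] by simp

text \<open>At most one class \<open>D\<close> can occur twice among three points. If none does, the
  excess \<open>E\<close> is not positive. Otherwise \<open>E \<le> p D / 2 - \<rho>\<close> with
  \<open>\<rho>\<close> the weight of the classes missed by the line. A missed class of weight 1
  makes this negative; if none is missed, \<open>E\<close> exceeds 3/4 although it is at most
  1/2.\<close>

lemma card_K_ne_3: "card (K l) \<noteq> 3"
proof
  assume w: "card (K l) = 3"
  define i where "i = card {x \<in> K l. x mod c < s}"
  have ne: "K l \<noteq> {}" using w by auto
  obtain k :: int where k: "2 * k \<le> 2 * m + i" "i \<noteq> 2 \<Longrightarrow> 2 * k \<le> 2 * m + i - 1"
    and ex: "(\<Sum>x\<in>K l. deg x - V x) \<le> (real 3 - 2) * sum p (K l) + (k + 2 * m - 1 - int 3 * m - i / 2) * T - (real 3 / 2 - 1) * Ts"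
    by (rule excess_K_le[OF ne, unfolded w, folded i_def]) (rule that)
  define E where "E = (\<Sum>x\<in>K l. deg x - V x)"
  have Epos: "0 < E" unfolding E_def using sum_excess_pos w by simp
  have E: "E \<le> sum p (K l) + (k - m - 1 - i / 2) * T - Ts / 2"
    using ex unfolding E_def by (simp add: algebra_simps)
  have k': "k - m - 1 - i / 2 \<le> - 1" using k(1) by linarith
  have E1: "E \<le> sum p (K l) - T - Ts / 2"
    using E mult_right_mono[OF k' T_nonneg] by simp
  have E2: "E \<le> sum p (K l) - 3 / 2 * T - Ts / 2" if "i \<noteq> 2"
  proof -
    have "real_of_int (2 * k) \<le> real_of_int (2 * m + i - 1)" using k(2)[OF that] of_int_le_iff by blast
    hence "k - m - 1 - i / 2 \<le> - (3 / 2)" by simp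
    from mult_right_mono[OF this T_nonneg] show ?thesis using E by simp
  qed
  show False
  proof (cases "\<exists>D\<in>{0..<c}. mult l D = 2")
    case False
    have "mult l r \<le> 1" if "r \<in> {0..<c}" for r 
    proof -
      have "mult l r \<noteq> 2" using False that by blast
      thus ?thesis using mult_le_2[of l r] by linarith
    qed
    hence "sum p (K l) \<le> T" unfolding sum_p_K T_def
      using p_nonneg by (intro sum_mono) (auto intro!: mult_left_le_one_le)
    thus False using E1 Epos Ts_nonneg by linarith
  next
    case True
    then obtain D where D: "D \<in> {0..<c}" "mult l D = 2" by blast
    have others: "mult l r \<le> 1" if "r \<in> {0..<c}" "r \<noteq> D" for r
    proof -
      have "(\<Sum>x\<in>{D, r}. mult l x) \<le> card (K l)" unfolding card_K_eq
        using that D by (intro sum_mono2) auto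
      thus ?thesis using that D w by simp
    qed
    define \<rho> where "\<rho> = (\<Sum>r\<in>{0..<c}. if mult l r = 0 then p r else 0)"
    have Dsum: "(\<Sum>r\<in>{0..<c}. if r = D then p r else 0) = p D" using D by simp
    have bound: "E \<le> p D / 2 - \<rho>"
    proof (cases "i = 2")
      case True
      \<comment> \<open>Otherwise the two points of class \<open>D\<close> and the two of offset
        below \<open>s\<close> would be four points on the line.\<close>
      have "D < s" using card_low_le[of D l] D w True unfolding i_def by force
      hence "p D \<le> Ts" using D p_le_Ts by simp
      moreover have "sum p (K l) - T \<le> p D - \<rho>"
        unfolding sum_p_K T_def \<rho>_def Dsum[symmetric] sum_subtractf[symmetric]
      proof (intro sum_mono)
        fix r assume r: "r \<in> {0..<c}"
        consider "r = D" | "r \<noteq> D" "mult l r = 0" | "r \<noteq> D" "mult l r = 1"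
          using others[OF r] by fastforce
        thus "real (mult l r) * p r - p r \<le> (if r = D then p r else 0) - (if mult l r = 0 then p r else 0)"
          using D by cases auto
      qed
      ultimately show ?thesis using E1 by linarith
    next
      case False
      have "sum p (K l) - 3 / 2 * T \<le> p D / 2 - \<rho>"
        unfolding sum_p_K T_def \<rho>_def Dsum[symmetric] sum_subtractf[symmetric] sum_distrib_left sum_divide_distrib
      proof (intro sum_mono)
        fix r assume r: "r \<in> {0..<c}"
        consider "r = D" | "r \<noteq> D" "mult l r = 0" | "r \<noteq> D" "mult l r = 1"
          using others[OF r] by fastforce
        thus "real (mult l r) * p r - 3 / 2 * p r \<le> (if r = D then p r else 0) / 2 - (if mult l r = 0 then p r else 0)"
          using D p_nonneg[of r] by cases auto
      qed
      thus ?thesis using E2[OF False] Ts_nonneg by linarith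
    qed
    have "1 \<le> mult l r" if r: "r \<in> {0..<c}" "p r = 1" for r
    proof (rule ccontr)
      assume "\<not> ?thesis"
      hence "1 \<le> (if mult l r = 0 then p r else 0)" using r by simp
      also have "\<dots> \<le> \<rho>" unfolding \<rho>_def using r p_nonneg by (intro member_le_sum) auto
      finally show False using bound Epos p_le_1[of D] by linarith
    qed
    hence "3 / 4 < E" using capped_subset_K_sum[of 1 l] w unfolding E_def by simp
    moreover have "0 \<le> \<rho>" unfolding \<rho>_def using p_nonneg by (intro sum_nonneg) auto
    ultimately show False using bound p_le_1[of D] by linarith
  qed
qed

text \<open>For \<open>m \<ge> 3\<close> the bound on the excess is already nonpositive, because no
  class occurs more than twice. For \<open>m = 2\<close> it is at most \<open>1 - \<rho>\<close>,
  with \<open>\<rho>\<close> the weight of the classes not occurring twice. Hence every class of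
  weight 1 occurs twice, which makes the excess larger than 3/2.\<close>

lemma card_K_less_4:
  assumes m2: "2 \<le> m"
  shows "card (K l) < 4"
proof (rule ccontr)
  assume "\<not> ?thesis"
  hence w4: "4 \<le> card (K l)" by simp
  define i w y where "i = card {x \<in> K l. x mod c < s}" and "w = card (K l)" and "y = real w - 2"
  have y: "2 \<le> y" using w4 unfolding y_def w_def by simp
  have ne: "K l \<noteq> {}" using w4 by auto
  obtain k :: int where k: "2 * k \<le> 2 * m + i"
    and ex: "(\<Sum>x\<in>K l. deg x - V x) \<le> (real w - 2) * sum p (K l) + (k + 2 * m - 1 - int w * m - i / 2) * T - (real w / 2 - 1) * Ts"
    unfolding i_def w_def by (rule excess_K_le[OF ne])
  define E where "E = (\<Sum>x\<in>K l. deg x - V x)"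
  have Epos: "0 < E" unfolding E_def using sum_excess_pos w4 by simp
  have "k + 2 * m - 1 - int w * m - i / 2 \<le> m - 1 - y * m"
    using k unfolding y_def by (simp add: algebra_simps)
  from mult_right_mono[OF this T_nonneg]
  have E: "E \<le> y * sum p (K l) + (m - 1 - y * m) * T - y / 2 * Ts"
    using ex unfolding E_def y_def by (simp add: algebra_simps diff_divide_distrib)
  show False
  proof (cases "m = 2")
    case False
    hence m3: "3 \<le> m" using m2 by simp
    have "y * sum p (K l) \<le> y * (2 * T)" using sum_p_K_le y by (intro mult_left_mono) auto
    moreover have "0 \<le> y / 2 * Ts" using y Ts_nonneg by simp
    ultimately have "E \<le> y * (2 * T) + (m - 1 - y * m) * T" using E by linarith
    hence "E \<le> (2 * y + m - 1 - y * m) * T" by (simp add: algebra_simps)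
    moreover have "(y - 2) * (m - 2) \<ge> 0" using y m3 by simp
    hence "2 * y + m - 1 - y * m \<le> 0" using m3 by (simp add: algebra_simps)
    ultimately show False using Epos T_nonneg mult_nonpos_nonneg[of "2 * y + m - 1 - y * m" T] by linarith
  next
    case True
    have "E \<le> T - y * (2 * T - sum p (K l) + Ts / 2)" using E unfolding True by (simp add: algebra_simps)
    \<comment> \<open>The bracket is nonnegative by \<open>sum_p_K_le\<close>, so the smallest value
      \<open>y = 2\<close> is the worst case.\<close>
    also have "\<dots> \<le> T - 2 * (2 * T - sum p (K l) + Ts / 2)"
      using mult_right_mono[OF y, of "2 * T - sum p (K l) + Ts / 2"] sum_p_K_le[of l] Ts_nonneg by simp
    finally have E': "E \<le> 2 * sum p (K l) - 3 * T - Ts" by simp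
    have uniq: "r = r'" if r: "r \<in> {0..<c}" "mult l r = 2" "\<not> r < s" and r': "r' \<in> {0..<c}" "mult l r' = 2" "\<not> r' < s" for r r'
    proof -
      \<comment> \<open>An offset of at least \<open>s\<close> cannot occur in the last, partial
        block, so two points of the class lie exactly \<open>c\<close> apart;
        \<open>equal_gaps\<close> then leaves only one such class.\<close>
      have step: "\<exists>x. x \<in> line l \<and> x + 1 * c \<in> line l \<and> x mod c = r" if r: "mult l r = 2" "\<not> r < s" for r
      proof -
        obtain x y where xy: "x \<in> K l" "y \<in> K l" "x < y" "x mod c = r" "y mod c = r"
          by (rule mult_2_obtain[OF r(1)])
        have l: "x \<in> line l" "y \<in> line l" using xy unfolding K_def by auto
        have "snd l \<le> x div c" by (rule line_block_bounds(1)[OF l(1)])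
        moreover have "y div c \<noteq> snd l + m" using line_block_bounds(3)[OF l(2)] xy(5) r(2) by auto
        hence "y div c \<le> snd l + 1" using line_block_bounds(2)[OF l(2)] True by linarith
        moreover have "x div c \<noteq> y div c" using xy by (metis mult_div_mod_eq order_less_irrefl)
        moreover have "x div c \<le> y div c" using xy c_pos by (intro zdiv_mono1) auto
        ultimately have "y div c = x div c + 1" by linarith
        hence "y = x + 1 * c" using mult_div_mod_eq[of c x] mult_div_mod_eq[of c y] xy by (simp add: algebra_simps)
        thus ?thesis using l xy by blast
      qed
      obtain x x' where "x \<in> line l" "x + 1 * c \<in> line l" "x mod c = r" "x' \<in> line l" "x' + 1 * c \<in> line l" "x' mod c = r'"
        using step[OF r(2,3)] step[OF r'(2,3)] by blast
      thus ?thesis using equal_gaps[of x l 1 x'] by simp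
    qed
    define S where "S = {r \<in> {0..<c}. mult l r = 2 \<and> \<not> r < s}"
    define \<rho> where "\<rho> = (\<Sum>r\<in>{0..<c}. if mult l r \<le> 1 then p r else 0)"
    have "(\<Sum>r\<in>S. p r) \<le> 1"
    proof (cases "S = {}")
      case False
      then obtain r where "r \<in> S" by blast
      hence "S = {r}" using uniq unfolding S_def by blast
      thus ?thesis using p_le_1 by simp
    qed simp
    \<comment> \<open>The coefficient of \<open>p r\<close> on the left is positive only for a class
      that occurs twice and has offset at least \<open>s\<close>.\<close>
    moreover have "2 * sum p (K l) - 3 * T - Ts \<le> (\<Sum>r\<in>{0..<c}. if r \<in> S then p r else 0) - \<rho>"
      unfolding sum_p_K T_def Ts_alt \<rho>_def sum_subtractf[symmetric] sum_distrib_left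
    proof (intro sum_mono)
      fix r assume r: "r \<in> {0..<c}"
      consider "mult l r = 0" | "mult l r = 1" | "mult l r = 2" using mult_le_2[of l r] by linarith
      thus "2 * (real (mult l r) * p r) - 3 * p r - (if r < s then p r else 0)
        \<le> (if r \<in> S then p r else 0) - (if mult l r \<le> 1 then p r else 0)"
        using p_nonneg[of r] r by cases (auto simp: S_def)
    qed
    moreover have "(\<Sum>r\<in>{0..<c}. if r \<in> S then p r else 0) = (\<Sum>r\<in>S. p r)"
      by (intro sum.mono_neutral_cong_right) (auto simp: S_def)
    ultimately have bound: "E \<le> 1 - \<rho>" using E' by linarith
    have "2 \<le> mult l r" if r: "r \<in> {0..<c}" "p r = 1" for r
    proof (rule ccontr)
      assume "\<not> ?thesis"
      hence "1 \<le> (if mult l r \<le> 1 then p r else 0)" using r by simp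
      also have "\<dots> \<le> \<rho>" unfolding \<rho>_def using r p_nonneg by (intro member_le_sum) auto
      finally show False using bound Epos by linarith
    qed
    hence "3 / 2 < E" using capped_subset_K_sum[of 2 l] w4 unfolding E_def by simp
    moreover have "0 \<le> \<rho>" unfolding \<rho>_def using p_nonneg by (intro sum_nonneg) auto
    ultimately show False using bound by linarith
  qed
qed

lemma KKT_False:
  assumes m2: "2 \<le> m"
  shows False
proof -
  have "card (K l) \<le> 2" for l using card_K_less_4[OF m2, of l] card_K_ne_3[of l] by linarith
  moreover have "{r\<in>{0..<c}. p r = 1} \<noteq> {}"
  proof
    assume e: "{r\<in>{0..<c}. p r = 1} = {}"
    show False using capped unfolding e by simp
  qed
  then obtain r where "p r = 1" by blast
  hence "0 < p r" by simp
  ultimately show False using deg_exceeds_V_False \<eta> deg_ge by blast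
qed

end

end

section \<open>The quotient graph modulo the period\<close>

context shifted_lines
begin

text \<open>The adjacency matrix of the quotient graph, with multiplicities. A diagonal entry counts
  each edge orbit within a class once in each direction.\<close>

definition B :: "int \<Rightarrow> int \<Rightarrow> nat" where "B r j = card {y \<in> nbr r. y mod c = j}"

text \<open>Translating the edge from \<open>r\<close> to \<open>y\<close> by
  \<open>- (y div c) * c\<close> and reversing it gives an edge that starts at
  \<open>j\<close>.\<close>

lemma B_sym:
  assumes "r \<in> {0..<c}" "j \<in> {0..<c}"
  shows "B r j = B j r"
  unfolding B_def
proof (rule bij_betw_same_card[OF bij_betw_byWitness[where f = "\<lambda>y. r - y div c * c" and f' = "\<lambda>y. j - y div c * c"]])
  have r: "r mod c = r" "r div c = 0" "j mod c = j" "j div c = 0" using assms by auto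
  have d: "(a - k * c) div c = - k" "(a - k * c) mod c = a" if "a div c = 0" "a mod c = a" for a k
    using that c_pos div_mult_self1[of c a "- k"] mod_mult_self1[of a "- k" c] by auto
  have y: "a = b + a div c * c" if "a mod c = b" for a b :: int using div_mult_mod_eq[of a c] that by linarith
  show "\<forall>a\<in>{y \<in> nbr r. y mod c = j}. j - (r - a div c * c) div c * c = a"
    using y d(1)[OF r(2,1)] by fastforce
  show "\<forall>a\<in>{y \<in> nbr j. y mod c = r}. r - (j - a div c * c) div c * c = a"
    using y d(1)[OF r(4,3)] by fastforce
  have sh: "adj b (a - k div c * c)" if "adj a k" "k mod c = b" for a b k
  proof -
    have "adj (a + - (k div c) * c) (k + - (k div c) * c)" using that(1) adj_shift by blast
    moreover have "k + - (k div c) * c = b" using y[OF that(2)] by simp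
    ultimately show ?thesis using adj_sym by simp
  qed
  show "(\<lambda>y. r - y div c * c) ` {y \<in> nbr r. y mod c = j} \<subseteq> {y \<in> nbr j. y mod c = r}"
    using sh[of r] d(2)[OF r(2,1)] unfolding nbr_def by auto
  show "(\<lambda>y. j - y div c * c) ` {y \<in> nbr j. y mod c = r} \<subseteq> {y \<in> nbr r. y mod c = j}"
    using sh[of j] d(2)[OF r(4,3)] unfolding nbr_def by auto
qed

text \<open>A neighbour at distance \<open>k * c\<close> on one side yields, by translation, one at
  the same distance on the other side.\<close>

lemma B_diag_ge_2:
  assumes "adj x y" "x mod c = y mod c"
  shows "2 \<le> B (x mod c) (x mod c)"
proof -
  define r where "r = x mod c"
  have rr: "r mod c = r" unfolding r_def by simp
  have x: "x = r + x div c * c" unfolding r_def using div_mult_mod_eq[of x c] by linarith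
  have y: "y = r + y div c * c" unfolding r_def assms(2) using div_mult_mod_eq[of y c] by linarith
  define k where "k = y div c - x div c"
  have a1: "adj r (r + k * c)"
    using adj_shift[of r "x div c" "r + k * c"] assms(1) x y unfolding k_def by (simp add: algebra_simps)
  have a2: "adj r (r + (- k) * c)"
    using adj_shift[of "r + (- k) * c" k r] a1 adj_sym by simp
  have "k * c \<noteq> 0" using a1 unfolding adj_def by auto
  hence "card {r + k * c, r + (- k) * c} = 2" by simp
  moreover have "{r + k * c, r + (- k) * c} \<subseteq> {z \<in> nbr r. z mod c = r}"
    using a1 a2 rr mod_mult_self1[of r k c] mod_mult_self1[of r "- k" c] unfolding nbr_def by auto
  ultimately show ?thesis unfolding B_def r_def[symmetric]
    using card_mono[of "{z \<in> nbr r. z mod c = r}" "{r + k * c, r + (- k) * c}"] finite_nbr[of r] by simp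
qed

end

context weighted_lines
begin

lemma deg_eq_B: "deg x = (\<Sum>j\<in>{0..<c}. B x j * p j)"
proof -
  have "deg x = (\<Sum>j\<in>{0..<c}. \<Sum>y\<in>{y \<in> nbr x. y mod c = j}. p y)"
    unfolding deg_def using finite_nbr c_pos by (intro sum.group[symmetric]) auto
  also have "\<dots> = (\<Sum>j\<in>{0..<c}. \<Sum>y\<in>{y \<in> nbr x. y mod c = j}. p j)"
    using p_mod by (intro sum.cong refl) (metis (mono_tags, lifting) mem_Collect_eq)
  finally show ?thesis unfolding B_def by simp
qed

lemma sum_p_V: "(\<Sum>r\<in>{0..<c}. p r * V r) = m * T\<^sup>2 + Ts * T"
proof -
  have "(\<Sum>r\<in>{0..<c}. p r * V r) = (\<Sum>r\<in>{0..<c}. p r * (m * T + Ts / 2) + (if r < s then p r else 0) * (T / 2))"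
    unfolding V_def by (intro sum.cong refl) (auto simp: algebra_simps)
  also have "\<dots> = T * (m * T + Ts / 2) + Ts * (T / 2)"
    unfolding sum.distrib sum_distrib_right[symmetric] Ts_alt T_def ..
  finally show ?thesis by (simp add: algebra_simps power2_eq_square)
qed

end

section \<open>Windows of less than two periods\<close>

text \<open>The weight \<open>p\<close> is the indicator of a minimal set of classes violating the
  bound. \<open>total_ge\<close> is the violation, by at least 1 because of integrality;
  \<open>deg_ge\<close> expresses that removing the class \<open>r\<close> restores the
  bound.\<close>

locale indicator_lines = weighted_lines +
  assumes m1: "m = 1" and p01: "p x = 0 \<or> p x = 1"
    and deg_ge: "r \<in> {0..<c} \<Longrightarrow> p r = 1 \<Longrightarrow> B r r + 2 * T + Ts + (if r < s then T - 1 else 0) \<le> 2 * deg r"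
    and total_ge: "T\<^sup>2 + Ts * T + 1 \<le> (\<Sum>r\<in>{0..<c}. p r * deg r)"
begin

lemma p_pos_iff: "0 < p x \<longleftrightarrow> p x = 1"
  using p01[of x] by auto

lemma sum_p_card: "finite X \<Longrightarrow> sum p X = real (card {x \<in> X. 0 < p x})"
proof -
  assume X: "finite X"
  have "sum p X = (\<Sum>x\<in>X. if 0 < p x then 1 else 0)"
  proof (intro sum.cong refl)
    show "p x = (if 0 < p x then 1 else 0)" for x using p01[of x] by auto
  qed
  thus ?thesis using X by (simp add: sum.If_cases Int_def)
qed

lemma sum_p_Ints: "finite X \<Longrightarrow> sum p X \<in> \<int>"
  using sum_p_card by simp

lemma deg_mod_ge:
  assumes "0 < p x"
  shows "B (x mod c) (x mod c) + 2 * T + Ts + (if x mod c < s then T - 1 else 0) \<le> 2 * deg x"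
  using deg_ge[of "x mod c"] assms c_pos p_pos_iff p_mod[of x] deg_mod[of x] by simp

lemma T_ge_1: "1 \<le> T"
proof (rule ccontr)
  assume "\<not> ?thesis"
  moreover have "T \<in> \<int>" unfolding T_def by (intro sum_p_Ints) simp
  ultimately have "T = 0" using T_nonneg by (auto elim!: Ints_cases)
  hence "\<And>r. r \<in> {0..<c} \<Longrightarrow> p r = 0" unfolding T_def using p_nonneg by (simp add: sum_nonneg_eq_0_iff)
  hence "(\<Sum>r\<in>{0..<c}. p r * deg r) = 0" by simp
  thus False using total_ge \<open>T = 0\<close> by simp
qed

text \<open>A point of the support sees at most its whole reach without itself. Summing this over
  the support and comparing with \<open>total_ge\<close> leaves \<open>1 \<le> (Ts - 1) * T\<close>,
  and \<open>Ts\<close> is an integer.\<close>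

lemma Ts_ge_2: "2 \<le> Ts"
proof -
  have bound: "p r * deg r \<le> p r * (T + Ts - 1) + (if r < s then p r else 0) * T" if r: "r \<in> {0..<c}" for r
  proof (cases "p r = 1")
    case True
    have "lo r \<le> r \<and> r < hi r"
    proof -
      have "r div c = 0" "r mod c = r" using r by auto
      thus ?thesis unfolding lo_eq hi_def using r m1 s_less s_nonneg c_pos by auto
    qed
    hence "nbr r \<subseteq> {lo r..<hi r} - {r}" using nbr_subset unfolding nbr_def adj_def by auto
    hence "deg r \<le> sum p ({lo r..<hi r} - {r})" unfolding deg_def
      by (intro sum_mono2) (auto intro: p_nonneg)
    also have "\<dots> = sum p {lo r..<hi r} - 1" using \<open>lo r \<le> r \<and> r < hi r\<close> True by (simp add: sum_diff1)
    also have "\<dots> = (if r < s then 2 else 1) * T + Ts - 1"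
      using r m1 by (subst sum_reach) (auto simp: algebra_simps)
    finally show ?thesis using True by (auto simp: algebra_simps)
  next
    case False
    thus ?thesis using p01[of r] by simp
  qed
  have "(\<Sum>r\<in>{0..<c}. p r * deg r) \<le> (\<Sum>r\<in>{0..<c}. p r * (T + Ts - 1) + (if r < s then p r else 0) * T)"
    using bound by (intro sum_mono) auto
  also have "\<dots> = T * (T + Ts - 1) + Ts * T"
    unfolding sum.distrib sum_distrib_right[symmetric] Ts_alt T_def ..
  finally have "1 \<le> (Ts - 1) * T" using total_ge by (simp add: algebra_simps power2_eq_square)
  hence "1 < Ts" using T_nonneg by (smt (verit) mult_nonpos_nonneg)
  moreover have "Ts \<in> \<int>" unfolding Ts_def by (intro sum_p_Ints) simp
  ultimately show ?thesis by (auto elim!: Ints_cases)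
qed

lemma mult_le_indicator: "mult l r \<le> (if p r = 1 then 2 else 0)"
  using mult_le_2[of l r] mult_pos[of l r] p01[of r] by (cases "mult l r = 0") auto

text \<open>The excess \<open>E\<close> of the line is bounded above by \<open>excess_K_le\<close>
  and below by minimality. The two bounds leave only a line carrying every class of the support
  exactly once, and there \<open>E\<close> is the total excess, which is at least 1.\<close>

lemma card_K_le_2: "card (K l) \<le> 2"
proof (rule ccontr)
  assume "\<not> ?thesis"
  hence w3: "3 \<le> card (K l)" by simp
  define i w y where "i = card {x \<in> K l. x mod c < s}" and "w = card (K l)" and "y = real w - 2"
  define E where "E = (\<Sum>x\<in>K l. deg x - V x)"
  have y: "1 \<le> y" using w3 unfolding y_def w_def by simp
  have ne: "K l \<noteq> {}" using w3 by auto
  obtain k :: int where k: "k \<le> m + 1" "i \<noteq> 2 \<Longrightarrow> 2 * k \<le> 2 * m + i - 1"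
    and ex: "(\<Sum>x\<in>K l. deg x - V x) \<le> (real w - 2) * sum p (K l) + (k + 2 * m - 1 - int w * m - i / 2) * T - (real w / 2 - 1) * Ts"
    by (rule excess_K_le[OF ne, folded i_def w_def]) (rule that)
  have "sum p (K l) = w" unfolding w_def using p_pos_iff unfolding K_def by (simp add: finite_line)
  hence E: "E \<le> y * w + (k - y - 1 - i / 2) * T - y / 2 * Ts"
    using ex m1 unfolding E_def y_def by (simp add: algebra_simps diff_divide_distrib)
  have "(\<Sum>x\<in>K l. (B (x mod c) (x mod c) - (if x mod c < s then 1 else 0 :: real)) / 2) \<le> E"
    unfolding E_def
  proof (intro sum_mono)
    fix x assume "x \<in> K l"
    thus "(B (x mod c) (x mod c) - (if x mod c < s then 1 else 0 :: real)) / 2 \<le> deg x - V x"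
      using deg_mod_ge[of x] m1 unfolding K_def V_def by (auto simp: field_simps)
  qed
  moreover have "(\<Sum>x\<in>K l. (B (x mod c) (x mod c) - (if x mod c < s then 1 else 0 :: real)) / 2)
     = (\<Sum>x\<in>K l. real (B (x mod c) (x mod c))) / 2 - i / 2"
    unfolding i_def using finite_K
    by (simp add: sum_subtractf sum.If_cases Int_def diff_divide_distrib flip: sum_divide_distrib)
  ultimately have low: "(\<Sum>x\<in>K l. real (B (x mod c) (x mod c))) / 2 - i / 2 \<le> E" by simp
  have iw: "i \<le> w" unfolding i_def w_def using finite_K by (intro card_mono) auto
  have T_sum: "real w = (\<Sum>r\<in>{0..<c}. real (mult l r))" unfolding w_def card_K_eq by simp
  have yT: "y \<le> y / 2 * Ts" using mult_left_mono[OF Ts_ge_2, of "y / 2"] y by simp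
  show False
  proof (cases "\<exists>D\<in>{0..<c}. mult l D = 2")
    case False
    have m_le: "real (mult l r) \<le> p r" if "r \<in> {0..<c}" for r
    proof -
      have "mult l r \<noteq> 2" using False that by blast
      hence "mult l r \<le> 1" using mult_le_2[of l r] by linarith
      thus ?thesis using mult_le_indicator[of l r] p01[of r] by auto
    qed
    have wT: "w \<le> T" unfolding T_sum T_def using m_le by (intro sum_mono) auto
    have nn: "0 \<le> (\<Sum>x\<in>K l. real (B (x mod c) (x mod c)))" by (intro sum_nonneg) auto
    have ywT: "y * w \<le> y * T" using wT y by (intro mult_left_mono) auto
    show False
    proof (cases "i = 2")
      case False
      have "real_of_int (2 * k) \<le> real_of_int (2 * m + i - 1)" using k(2)[OF False] of_int_le_iff by blast
      hence "k - y - 1 - i / 2 \<le> - y - 1 / 2" using m1 by simp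
      from mult_right_mono[OF this T_nonneg]
      have "E \<le> y * w + (- y - 1 / 2) * T - y / 2 * Ts" using E by linarith
      hence "E \<le> - T / 2 - y" using ywT yT by (simp add: algebra_simps)
      thus False using low nn iw wT y by linarith
    next
      case True
      have "k - y - 1 - i / 2 \<le> - y" using k(1) m1 True by simp
      from mult_right_mono[OF this T_nonneg]
      have "E \<le> y * w - y * T - y / 2 * Ts" using E by linarith
      hence *: "y * (T - w) + y / 2 * Ts \<le> 1" using low nn True by (simp add: algebra_simps)
      have "0 \<le> y * (T - w)" using wT y by simp
      \<comment> \<open>Since \<open>y / 2 * Ts\<close> is at least \<open>y \<ge> 1\<close>, there
        is no slack: \<open>w = 3\<close> and the line meets every class of the support.\<close>
      hence "y \<le> 1" "y * (T - w) = 0" using * yT y by linarith+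
      hence Tw: "T = w" "y = 1" using y by auto
      have "p r = real (mult l r)" if r: "r \<in> {0..<c}" for r
      proof -
        have "(\<Sum>r\<in>{0..<c}. p r - real (mult l r)) = 0"
          using Tw unfolding T_sum T_def by (simp add: sum_subtractf)
        thus ?thesis using sum_nonneg_eq_0_iff[of "{0..<c}" "\<lambda>r. p r - real (mult l r)"] m_le r by simp
      qed
      hence "E = (\<Sum>r\<in>{0..<c}. p r * (deg r - V r))"
        unfolding E_def by (subst sum_K_by_class) (auto simp: deg_mod V_mod)
      also have "\<dots> = (\<Sum>r\<in>{0..<c}. p r * deg r) - (T\<^sup>2 + Ts * T)"
        using sum_p_V m1 by (simp add: right_diff_distrib sum_subtractf)
      also have "\<dots> \<ge> 1" using total_ge by simp
      finally have "1 \<le> E" .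
      thus False using \<open>E \<le> y * w - y * T - y / 2 * Ts\<close> Tw Ts_ge_2 by simp
    qed
  next
    case True
    then obtain D where D: "D \<in> {0..<c}" "mult l D = 2" by blast
    \<comment> \<open>For \<open>m = 1\<close> two points of one class lie in the first and the last
      block of the window, so their distance is \<open>c\<close> and their offset is below
      \<open>s\<close>.\<close>
    have dbl: "\<exists>x. x \<in> K l \<and> x + 1 * c \<in> K l \<and> x mod c = r \<and> r < s" if r2: "mult l r = 2" for r
    proof -
      obtain x y where xy: "x \<in> K l" "y \<in> K l" "x < y" "x mod c = r" "y mod c = r"
        by (rule mult_2_obtain[OF r2])
      have l: "x \<in> line l" "y \<in> line l" using xy unfolding K_def by auto
      have "snd l \<le> x div c" by (rule line_block_bounds(1)[OF l(1)])
      moreover have "y div c \<le> snd l + 1" using line_block_bounds(2)[OF l(2)] m1 by simp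
      moreover have "x div c \<noteq> y div c" using xy by (metis mult_div_mod_eq order_less_irrefl)
      moreover have "x div c \<le> y div c" using xy c_pos by (intro zdiv_mono1) auto
      ultimately have d: "y div c = x div c + 1" "y div c = snd l + m" using m1 by linarith+
      have "y = x + 1 * c" using mult_div_mod_eq[of c x] mult_div_mod_eq[of c y] xy d by (simp add: algebra_simps)
      thus ?thesis using xy line_block_bounds(3)[OF l(2) d(2)] by auto
    qed
    obtain x where x: "x \<in> K l" "x + 1 * c \<in> K l" "x mod c = D" "D < s" using dbl[OF D(2)] by blast
    have uniq: "r = D" if r2: "mult l r = 2" for r
    proof -
      obtain x' where "x' \<in> K l" "x' + 1 * c \<in> K l" "x' mod c = r" using dbl[OF r2] by blast
      thus ?thesis using equal_gaps[of x l 1 x'] x unfolding K_def by auto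
    qed
    have m_le: "real (mult l r) \<le> p r + (if r = D then 1 else 0)" for r
    proof (cases "r = D")
      case True
      thus ?thesis using mult_le_indicator[of l D] D p01[of D] by auto
    next
      case False
      hence "mult l r \<noteq> 2" using uniq by blast
      hence "mult l r \<le> 1" using mult_le_2[of l r] by linarith
      thus ?thesis using False mult_le_indicator[of l r] p01[of r] by auto
    qed
    have "w \<le> (\<Sum>r\<in>{0..<c}. p r + (if r = D then 1 else 0))"
      unfolding T_sum using m_le by (intro sum_mono) auto
    also have "\<dots> = T + 1" unfolding T_def sum.distrib using D by simp
    finally have wT: "w \<le> T + 1" .
    have "x \<in> line l" "x + 1 * c \<in> line l" "x \<noteq> x + 1 * c" using x c_pos unfolding K_def by auto
    hence "adj x (x + 1 * c)" unfolding adj_def by blast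
    hence "2 \<le> B D D" using B_diag_ge_2[of x "x + 1 * c"] x by simp
    \<comment> \<open>Both points of class \<open>D\<close> contribute \<open>B D D \<ge> 2\<close>;
      this diagonal term is what makes the lower bound on \<open>E\<close> strong enough.\<close>
    hence "4 \<le> real (mult l D) * real (B D D)" using D by simp
    also have "\<dots> \<le> (\<Sum>r\<in>{0..<c}. real (mult l r) * real (B r r))"
      using D by (intro member_le_sum) auto
    also have "\<dots> = (\<Sum>r\<in>{0..<c}. real (mult l r) * real (B (r mod c) (r mod c)))"
      by (intro sum.cong refl) auto
    also have "\<dots> = (\<Sum>x\<in>K l. real (B (x mod c) (x mod c)))"
      by (rule sum_K_by_class[symmetric]) simp
    finally have B4: "4 \<le> (\<Sum>x\<in>K l. real (B (x mod c) (x mod c)))" .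
    have i2: "2 \<le> i" using mult_le_card_low[OF D(1) x(4), of l] D unfolding i_def by simp
    have "k - y - 1 - i / 2 \<le> 1 - y - i / 2" using k(1) m1 by simp
    from mult_right_mono[OF this T_nonneg]
    have "E \<le> y * w + (1 - y - i / 2) * T - y / 2 * Ts" using E by linarith
    moreover have "y * w \<le> y * (T + 1)" using wT y by (intro mult_left_mono) auto
    ultimately have "2 - i / 2 \<le> (1 - i / 2) * T" using low B4 yT by (simp add: algebra_simps)
    hence "(i / 2 - 1) * (T - 1) + 1 \<le> 0" by (simp add: algebra_simps diff_divide_distrib)
    moreover have "0 \<le> (real i / 2 - 1) * (T - 1)" using i2 T_ge_1 by (intro mult_nonneg_nonneg) auto
    ultimately show False by linarith
  qed
qed

text \<open>The right degree need not increase strictly here, since \<open>deg_ge\<close> can fall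
  short of \<open>V\<close> by 1/2. Integrality turns the remaining slack into equalities. The
  conclusion on \<open>sum p {0..v mod c}\<close> says that \<open>v\<close> lies in the last class
  of the support below \<open>s\<close>.\<close>

lemma max_rdeg_step:
  assumes u: "0 < p u" "0 < rdeg u" and mx: "\<And>v. 0 < p v \<Longrightarrow> rdeg v \<le> rdeg u"
  obtains v where "adj u v" "0 < p v" "rdeg v = rdeg u" "v mod c < s" "sum p {0..v mod c} = Ts" "B (v mod c) (v mod c) < 2"
proof -
  obtain v where v: "adj u v" "0 < p v" "rdeg u + ldeg v \<le> sum p {lo v..v}"
    by (rule farthest_right_nbr[OF card_K_le_2 u])
  define \<Sigma> where "\<Sigma> = sum p {0..v mod c}"
  have deg: "B (v mod c) (v mod c) + 2 * T + Ts + (if v mod c < s then T - 1 else 0) \<le> 2 * deg v"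
    by (rule deg_mod_ge[OF v(2)])
  have left: "sum p {lo v..v} = (if v mod c < s then 1 else 0) * T + \<Sigma>"
    unfolding sum_left_reach \<Sigma>_def using m1 by simp
  have mv: "rdeg v \<le> rdeg u" by (rule mx[OF v(2)])
  have low: "v mod c < s"
  proof (rule ccontr)
    assume h: "\<not> ?thesis"
    have "\<Sigma> \<le> T" unfolding \<Sigma>_def T_def using pos_mod_bound[OF c_pos, of v]
      by (intro sum_mono2) (auto intro: p_nonneg)
    thus False using h deg left v(3) mv deg_split[of v] Ts_ge_2 by simp
  qed
  have \<Sigma>: "\<Sigma> \<le> Ts" unfolding \<Sigma>_def Ts_def using low
    by (intro sum_mono2) (auto intro: p_nonneg)
  \<comment> \<open>Twice the degree bound at \<open>v\<close>, with \<open>ldeg v\<close> replaced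
    by its upper bound \<open>T + \<Sigma> - rdeg u\<close>.\<close>
  have key: "B (v mod c) (v mod c) + Ts + T - 1 - 2 * \<Sigma> \<le> 2 * (rdeg v - rdeg u)"
    using low deg left v(3) deg_split[of v] by simp
  have ints: "\<Sigma> \<in> \<int>" "Ts \<in> \<int>" "rdeg v \<in> \<int>" "rdeg u \<in> \<int>"
    unfolding \<Sigma>_def Ts_def rdeg_def using finite_nbr by (auto intro!: sum_p_Ints)
  define \<beta> where "\<beta> = real (B (v mod c) (v mod c))"
  note key' = key[folded \<beta>_def]
  have B0: "0 \<le> \<beta>" unfolding \<beta>_def by simp
  have mv2: "2 * (rdeg v - rdeg u) \<le> 0" using mv by simp
  have b1: "\<beta> + Ts + T - 1 - 2 * \<Sigma> \<le> 0" by (rule order_trans[OF key' mv2])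
  have "\<beta> \<le> 1" using b1 \<Sigma> Ts_le_T by linarith
  hence "B (v mod c) (v mod c) < 2" unfolding \<beta>_def by simp
  moreover have "Ts - \<Sigma> < 1" using b1 \<Sigma> Ts_le_T B0 by linarith
  moreover have "- 1 \<le> \<beta> + Ts + T - 1 - 2 * \<Sigma>" using \<Sigma> Ts_le_T B0 by linarith
  hence "- 1 \<le> 2 * (rdeg v - rdeg u)" using key' by (rule order_trans)
  hence "- 1 < rdeg v - rdeg u" by simp
  ultimately have "\<Sigma> = Ts" "rdeg v = rdeg u" "B (v mod c) (v mod c) < 2"
    using ints \<Sigma> mv by (auto elim!: Ints_cases)
  thus ?thesis using that v low unfolding \<Sigma>_def by blast
qed

text \<open>Two successive steps of \<open>max_rdeg_step\<close> both end in the last class of the support below \<open>s\<close>, which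
  then has neighbours in itself, although \<open>B\<close> is less than 2 there.\<close>

lemma indicator_False: False
proof -
  have "\<exists>x. 0 < p x"
  proof (rule ccontr)
    assume n: "\<not> ?thesis"
    have "p x = 0" for x using p01[of x] p_pos_iff[of x] n by blast
    hence "T = 0" unfolding T_def by simp
    thus False using T_ge_1 by simp
  qed
  then obtain u where u: "0 < p u" "\<And>v. 0 < p v \<Longrightarrow> rdeg v \<le> rdeg u"
    using max_rdeg_exists by blast
  have upos: "0 < rdeg u"
  proof (rule ccontr)
    assume "\<not> ?thesis"
    hence "deg u = 0" using no_right_nbrs[of u] u by fastforce
    thus False using deg_mod_ge[OF u(1)] T_ge_1 Ts_ge_2 by (auto split: if_splits)
  qed
  obtain v where v: "adj u v" "0 < p v" "rdeg v = rdeg u" "v mod c < s" "sum p {0..v mod c} = Ts"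
    using max_rdeg_step[OF u(1) upos u(2)] by blast
  obtain v' where v': "adj v v'" "0 < p v'" "v' mod c < s" "sum p {0..v' mod c} = Ts" "B (v' mod c) (v' mod c) < 2"
    using max_rdeg_step[of v] v upos u(2) by metis
  \<comment> \<open>Equal prefix weights leave no point of the support strictly after
    \<open>a\<close> and up to \<open>b\<close>.\<close>
  have less: False if "a < b" "0 \<le> a" "sum p {0..a} = Ts" "sum p {0..b} = Ts" "0 < p b" for a b
  proof -
    have "sum p {0..a} + p b = sum p (insert b {0..a})" using that by (subst sum.insert) auto
    also have "\<dots> \<le> sum p {0..b}" using that by (intro sum_mono2) (auto intro: p_nonneg)
    finally show False using that by linarith
  qed
  have "v mod c = v' mod c"
    using less[of "v mod c" "v' mod c"] less[of "v' mod c" "v mod c"] v v' c_pos p_mod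
    by (metis linorder_neqE pos_mod_sign)
  thus False using B_diag_ge_2[OF v'(1)] v'(5) by simp
qed

end

section \<open>The bound on the average degree\<close>

context shifted_lines
begin

lemma weighted_linesI:
  assumes "\<And>r. 0 \<le> q r"
  shows "weighted_lines I A c m s (\<lambda>x. q (x mod c))"
  by unfold_locales (use assms in auto)

lemma sum_B: "(\<Sum>j\<in>{0..<c}. B r j) = card (nbr r)"
proof -
  have "card (nbr r) = (\<Sum>y\<in>nbr r. 1)" by simp
  also have "\<dots> = (\<Sum>j\<in>{0..<c}. \<Sum>y\<in>{y \<in> nbr r. y mod c = j}. 1)"
    using finite_nbr c_pos by (intro sum.group[symmetric]) auto
  finally show ?thesis unfolding B_def by simp
qed

lemma sum_low_1: "(\<Sum>j\<in>{0..<c}. if j < s then 1 else 0 :: real) = s"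
proof -
  have "(\<Sum>j\<in>{0..<c}. if j < s then 1 else 0 :: real) = (\<Sum>j\<in>{0..<s}. 1)"
    using s_less by (intro sum.mono_neutral_cong_right) auto
  thus ?thesis using s_nonneg by simp
qed

lemma sum_card_nbr_le_ge_2:
  assumes m2: "2 \<le> m"
  shows "(\<Sum>r\<in>{0..<c}. card (nbr r)) \<le> c * (m * c + s)"
proof (rule ccontr)
  assume "\<not> ?thesis"
  hence "c * (m * c + s) + 1 \<le> int (\<Sum>r\<in>{0..<c}. card (nbr r))" by simp
  hence "real_of_int (c * (m * c + s) + 1) \<le> real_of_int (int (\<Sum>r\<in>{0..<c}. card (nbr r)))"
    by (rule of_int_le_iff[THEN iffD2])
  hence big: "c * (m * c + s) + 1 \<le> (\<Sum>r\<in>{0..<c}. real (card (nbr r)))" by simp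
  \<comment> \<open>The perturbation makes the degree bound on the support strict. Its total cost
    \<open>\<zeta> * c\<^sup>2 = 1 / 4\<close> leaves 3/4 of the violation by at least 1.\<close>
  define \<zeta> :: real where "\<zeta> = 1 / (4 * c\<^sup>2)"
  have \<zeta>: "0 < \<zeta>" "\<zeta> * c\<^sup>2 = 1 / 4" using c_pos unfolding \<zeta>_def by auto
  \<comment> \<open>Chosen symmetric so that row \<open>i\<close> applied to the weights gives
    \<open>deg i - V i - \<zeta> * T\<close>.\<close>
  define M :: "int \<Rightarrow> int \<Rightarrow> real" where
    "M i j = B i j - (m + (if i < s then 1 / 2 else 0) + (if j < s then 1 / 2 else 0)) - \<zeta>" for i j
  have M_sym: "M i j = M j i" if "i \<in> {0..<c}" "j \<in> {0..<c}" for i j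
    unfolding M_def using B_sym[OF that] by simp
  obtain q where q: "\<And>i. 0 \<le> q i" "\<And>i. q i \<le> 1"
    "\<And>i. i \<in> {0..<c} \<Longrightarrow> 0 < q i \<Longrightarrow> 0 \<le> (\<Sum>j\<in>{0..<c}. M i j * q j)"
    "\<And>i. i \<in> {0..<c} \<Longrightarrow> q i < 1 \<Longrightarrow> (\<Sum>j\<in>{0..<c}. M i j * q j) \<le> 0"
    "(\<Sum>i\<in>{0..<c}. \<Sum>j\<in>{0..<c}. M i j) \<le> (\<Sum>i\<in>{0..<c}. \<Sum>j\<in>{0..<c}. M i j * q i * q j)"
    using box_maximum[of "{0..<c}" M] M_sym by auto
  define p where "p x = q (x mod c)" for x
  interpret weighted_lines I A c m s p
    unfolding p_def using q(1) by (rule weighted_linesI)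
  have pq: "p r = q r" if "r \<in> {0..<c}" for r using that unfolding p_def by simp
  have grad: "(\<Sum>j\<in>{0..<c}. M i j * q j) = deg i - V i - \<zeta> * T" if i: "i \<in> {0..<c}" for i
  proof -
    have "(\<Sum>j\<in>{0..<c}. M i j * q j) = (\<Sum>j\<in>{0..<c}. B i j * p j - (m + (if i < s then 1 / 2 else 0) + \<zeta>) * p j
       - (if j < s then p j else 0) / 2)"
      using pq by (intro sum.cong refl) (auto simp: M_def algebra_simps)
    also have "\<dots> = deg i - (m + (if i < s then 1 / 2 else 0) + \<zeta>) * T - Ts / 2"
      unfolding sum_subtractf deg_eq_B T_def Ts_alt sum_distrib_left sum_divide_distrib ..
    finally show ?thesis using i unfolding V_def by (auto simp: algebra_simps)
  qed
  have "(\<Sum>i\<in>{0..<c}. \<Sum>j\<in>{0..<c}. M i j) = (\<Sum>i\<in>{0..<c}. real (card (nbr i)) - c * (m + \<zeta>) - real_of_int c * (if i < s then 1 else 0) / 2 - s / 2)"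
  proof (intro sum.cong refl)
    fix i
    have "(\<Sum>j\<in>{0..<c}. M i j) = (\<Sum>j\<in>{0..<c}. real (B i j)) - c * (m + (if i < s then 1 / 2 else 0) + \<zeta>) - (\<Sum>j\<in>{0..<c}. (if j < s then 1 else 0 :: real)) / 2"
      unfolding M_def using c_pos
      by (simp add: sum_subtractf sum.distrib sum_divide_distrib algebra_simps if_distrib[of "\<lambda>x. x / 2"] cong: if_cong)
    also have "(\<Sum>j\<in>{0..<c}. real (B i j)) = card (nbr i)" using sum_B[of i] by (metis of_nat_sum)
    finally show "(\<Sum>j\<in>{0..<c}. M i j) = real (card (nbr i)) - c * (m + \<zeta>) - real_of_int c * (if i < s then 1 else 0) / 2 - s / 2"
      unfolding sum_low_1 by (auto simp: algebra_simps)
  qed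
  also have "\<dots> = (\<Sum>i\<in>{0..<c}. real (card (nbr i))) - c * (c * (m + \<zeta>)) - c * s / 2 - c * (s / 2)"
  proof -
    have "(\<Sum>i\<in>{0..<c}. real_of_int c * (if i < s then 1 else 0) / 2) = c * s / 2"
      using sum_low_1 by (simp flip: sum_distrib_left sum_divide_distrib)
    thus ?thesis using c_pos by (simp add: sum_subtractf)
  qed
  also have "\<dots> = (\<Sum>i\<in>{0..<c}. real (card (nbr i))) - c * (m * c + s) - 1 / 4"
    using \<zeta>(2) by (simp add: algebra_simps power2_eq_square)
  finally have "3 / 4 \<le> (\<Sum>i\<in>{0..<c}. \<Sum>j\<in>{0..<c}. M i j)" using big by simp
  also note q(5)
  also have "(\<Sum>i\<in>{0..<c}. \<Sum>j\<in>{0..<c}. M i j * q i * q j) = (\<Sum>i\<in>{0..<c}. q i * (\<Sum>j\<in>{0..<c}. M i j * q j))"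
    unfolding sum_distrib_left by (intro sum.cong refl) (simp add: algebra_simps)
  \<comment> \<open>At a weight strictly between 0 and 1 both optimality conditions apply and the
    gradient vanishes, so only classes of weight 1 contribute.\<close>
  also have "\<dots> = (\<Sum>i\<in>{i \<in> {0..<c}. p i = 1}. deg i - V i - \<zeta> * T)"
  proof (intro sum.mono_neutral_cong_right ballI)
    fix i assume i: "i \<in> {0..<c} - {i \<in> {0..<c}. p i = 1}"
    hence "q i < 1" using pq q(2)[of i] by force
    thus "q i * (\<Sum>j\<in>{0..<c}. M i j * q j) = 0" using q(3,4)[of i] q(1)[of i] i by fastforce
  qed (use pq grad in auto)
  finally have capped: "3 / 4 \<le> (\<Sum>i\<in>{i \<in> {0..<c}. p i = 1}. deg i - V i - \<zeta> * T)" .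
  have "0 < T"
  proof (rule ccontr)
    assume "\<not> ?thesis"
    hence "T = 0" using T_nonneg by simp
    hence "\<forall>r\<in>{0..<c}. p r = 0" unfolding T_def using p_nonneg by (simp add: sum_nonneg_eq_0_iff)
    hence e: "{i \<in> {0..<c}. p i = 1} = {}" by auto
    show False using capped unfolding e by simp
  qed
  show False
  proof (rule KKT_False[of "\<zeta> * T"])
    show "0 < \<zeta> * T" using \<zeta> \<open>0 < T\<close> by simp
    show "p x \<le> 1" for x unfolding p_def by (rule q(2))
    show "V x + \<zeta> * T \<le> deg x" if "0 < p x" for x
      using q(3)[of "x mod c"] grad[of "x mod c"] that c_pos deg_mod[of x] V_mod[of x] unfolding p_def by simp
    show "2 \<le> m" by (rule m2)
  qed (rule capped)
qed

text \<open>Strong induction over subsets makes a counterexample \<open>P\<close> minimal; its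
  indicator satisfies the assumptions of \<open>indicator_lines\<close>.\<close>

lemma sum_B_subset_le:
  assumes m1: "m = 1" and P: "P \<subseteq> {0..<c}"
  shows "(\<Sum>i\<in>P. \<Sum>j\<in>P. B i j) \<le> card P * card P + card (P \<inter> {0..<s}) * card P"
proof -
  have "finite P" using P finite_subset by blast
  thus ?thesis using P
  proof (induction P rule: finite_psubset_induct)
    case (psubset P)
    define b where "b P = card P * card P + card (P \<inter> {0..<s}) * card P" for P
    define e where "e P = (\<Sum>i\<in>P. \<Sum>j\<in>P. B i j)" for P
    show ?case
    proof (rule ccontr)
      assume "\<not> ?case"
      hence big: "b P + 1 \<le> e P" unfolding b_def e_def by simp
      define p :: "int \<Rightarrow> real" where "p x = (if x mod c \<in> P then 1 else 0)" for x
      interpret weighted_lines I A c m s p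
        unfolding p_def by (rule weighted_linesI) simp
      have pP: "p r = (if r \<in> P then 1 else 0)" if "r \<in> {0..<c}" for r using that unfolding p_def by simp
      have sumP: "(\<Sum>r\<in>{0..<c}. f r * p r) = (\<Sum>r\<in>P. f r)" for f :: "int \<Rightarrow> real"
        using psubset pP by (intro sum.mono_neutral_cong_right) auto
      have T: "T = card P" unfolding T_def using sumP[of "\<lambda>_. 1"] by simp
      have "Ts = (\<Sum>r\<in>P \<inter> {0..<s}. 1)" unfolding Ts_def using s_less pP
        by (intro sum.mono_neutral_cong_right) auto
      hence Ts: "Ts = card (P \<inter> {0..<s})" by simp
      have deg: "deg x = (\<Sum>j\<in>P. real (B x j))" for x unfolding deg_eq_B sumP ..
      have "indicator_lines I A c m s p"
      proof unfold_locales
        show "m = 1" by (rule m1)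
        show "p x = 0 \<or> p x = 1" for x unfolding p_def by simp
        have "T\<^sup>2 + Ts * T + 1 = real (b P + 1)" unfolding T Ts b_def by (simp add: power2_eq_square)
        also have "\<dots> \<le> real (e P)" using big of_nat_le_iff by blast
        also have "\<dots> = (\<Sum>r\<in>{0..<c}. deg r * p r)" unfolding sumP deg e_def by simp
        finally show "T\<^sup>2 + Ts * T + 1 \<le> (\<Sum>r\<in>{0..<c}. p r * deg r)" by (simp add: mult.commute)
        fix r assume r: "r \<in> {0..<c}" "p r = 1"
        hence rP: "r \<in> P" using pP by (auto split: if_splits)
        define Q where "Q = P - {r}"
        have PQ: "P = insert r Q" "r \<notin> Q" "finite Q" using rP psubset.hyps unfolding Q_def by auto
        have "(\<Sum>i\<in>Q. B i r) = (\<Sum>i\<in>Q. B r i)"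
          using psubset.prems r PQ by (intro sum.cong refl B_sym) auto
        \<comment> \<open>Removing \<open>r\<close> deletes its row and its column, equal by
          symmetry, whose common diagonal entry would be counted twice.\<close>
        hence eP: "real (e P) = real (e Q) + 2 * deg r - B r r"
          unfolding e_def deg PQ(1) using PQ(2,3) by (simp add: sum.distrib)
        have "e Q \<le> b Q" unfolding e_def b_def using psubset.IH[of Q] psubset.prems PQ by blast
        hence "real (e Q) \<le> real (b Q)" by simp
        moreover have "real (b P) = real (b Q) + 2 * T - 1 + Ts + (if r < s then T - 1 else 0)"
        proof (cases "r < s")
          case True
          have "P \<inter> {0..<s} = insert r (Q \<inter> {0..<s})" using PQ r True by auto
          hence "card (P \<inter> {0..<s}) = Suc (card (Q \<inter> {0..<s}))" using PQ by simp
          moreover have "card P = Suc (card Q)" using PQ by simp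
          ultimately show ?thesis unfolding T Ts b_def using True by (simp add: algebra_simps)
        next
          case False
          have "P \<inter> {0..<s} = Q \<inter> {0..<s}" using PQ r False by auto
          moreover have "card P = Suc (card Q)" using PQ by simp
          ultimately show ?thesis unfolding T Ts b_def using False by (simp add: algebra_simps)
        qed
        moreover have "real (b P) + 1 \<le> real (e P)" using big by linarith
        ultimately show "B r r + 2 * T + Ts + (if r < s then T - 1 else 0) \<le> 2 * deg r"
          using eP by linarith
      qed
      thus False by (rule indicator_lines.indicator_False)
    qed
  qed
qed

theorem sum_card_nbr_le: "(\<Sum>r\<in>{0..<c}. card (nbr r)) \<le> c * (m * c + s)"
proof (cases "m = 1")
  case True
  have "(\<Sum>r\<in>{0..<c}. card (nbr r)) \<le> card {0..<c} * card {0..<c} + card ({0..<c} \<inter> {0..<s}) * card {0..<c}"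
    using sum_B_subset_le[OF True, of "{0..<c}"] unfolding sum_B by simp
  also have "{0..<c} \<inter> {0..<s} = {0..<s}" using s_less by auto
  finally have "(\<Sum>r\<in>{0..<c}. card (nbr r)) \<le> nat c * nat c + nat s * nat c" by simp
  hence "int (\<Sum>r\<in>{0..<c}. card (nbr r)) \<le> int (nat c * nat c + nat s * nat c)" using of_nat_le_iff by blast
  also have "\<dots> = c * (m * c + s)" using c_pos s_nonneg True by (simp add: algebra_simps)
  finally show ?thesis .
next
  case False
  thus ?thesis using m_ge sum_card_nbr_le_ge_2 by simp
qed

text \<open>Both sides count ordered pairs of distinct points on a common line up to translation by
  \<open>c\<close>: on the left the first point is moved into \<open>{0..<c}\<close>, on the right
  the line is moved to its base position \<open>A i\<close>.\<close>

lemma sum_card_nbr: "(\<Sum>r\<in>{0..<c}. card (nbr r)) = (\<Sum>i\<in>I. card (A i) * (card (A i) - 1))"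
proof -
  have fA: "finite (A i)" if "i \<in> I" for i using A_subset[OF that] finite_subset by blast
  define X where "X = (SIGMA i:I. SIGMA x:A i. A i - {x})"
  define f :: "'i \<times> int \<times> int \<Rightarrow> int \<times> int" where "f = (\<lambda>(i, x, y). (x mod c, y - (x div c) * c))"
  have cX: "card X = (\<Sum>i\<in>I. card (A i) * (card (A i) - 1))"
    unfolding X_def using fA finite_I by (subst card_SigmaI) (auto intro!: sum.cong simp: card_SigmaI)
  have cN: "card (SIGMA r:{0..<c}. nbr r) = (\<Sum>r\<in>{0..<c}. card (nbr r))"
    using finite_nbr by (intro card_SigmaI) auto
  have mem: "x mod c \<in> line (i, - (x div c))" "y - (x div c) * c \<in> line (i, - (x div c))" "x mod c \<noteq> y - (x div c) * c"
    if "(i, x, y) \<in> X" for i x y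
  proof -
    have x: "x mod c + x div c * c = x" by simp
    show "x mod c \<in> line (i, - (x div c))" "y - (x div c) * c \<in> line (i, - (x div c))"
      using that unfolding X_def shifted_line_def by auto
    show "x mod c \<noteq> y - (x div c) * c"
    proof
      assume "x mod c = y - (x div c) * c"
      hence "y = x" using x by linarith
      thus False using that unfolding X_def by auto
    qed
  qed
  have bij: "bij_betw f X (SIGMA r:{0..<c}. nbr r)"
  proof (rule bij_betwI')
    fix t u assume tu: "t \<in> X" "u \<in> X"
    obtain i x y i' x' y' where eq: "t = (i, x, y)" "u = (i', x', y')" by (cases t, cases u) auto
    show "f t = f u \<longleftrightarrow> t = u"
    proof
      assume h: "f t = f u"
      hence h': "x mod c = x' mod c" "y - x div c * c = y' - x' div c * c" unfolding f_def eq by auto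
      have X: "(i, x, y) \<in> X" "(i', x', y') \<in> X" using tu unfolding eq by auto
      \<comment> \<open>Distinct lines through both points of the pair would contradict
        \<open>two_lines\<close>.\<close>
      have "(i, - (x div c)) = (i', - (x' div c))"
      proof (rule ccontr)
        assume "\<not> ?thesis"
        from two_lines[OF this mem(1)[OF X(1)] _ mem(2)[OF X(1)]] show False
          using mem[OF X(1)] mem(1,2)[OF X(2)] h' by auto
      qed
      hence d: "i = i'" "x div c = x' div c" by auto
      hence "x = x'" using h'(1) by (metis mult_div_mod_eq)
      thus "t = u" using h'(2) d unfolding eq by simp
    qed simp
  next
    fix t assume "t \<in> X"
    then obtain i x y where t: "t = (i, x, y)" "(i, x, y) \<in> X" by (cases t) auto
    note mem[OF t(2)]
    hence "adj (x mod c) (y - x div c * c)" unfolding adj_def by blast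
    thus "f t \<in> (SIGMA r:{0..<c}. nbr r)" unfolding f_def t(1) nbr_def using c_pos by auto
  next
    fix u assume "u \<in> (SIGMA r:{0..<c}. nbr r)"
    then obtain r z l where u: "u = (r, z)" "r \<in> {0..<c}" "r \<noteq> z" "r \<in> line l" "z \<in> line l"
      unfolding nbr_def adj_def by auto
    define x y where "x = r - snd l * c" and "y = z - snd l * c"
    have "(r + (- snd l) * c) div c = - snd l" "(r + (- snd l) * c) mod c = r"
      using u(2) c_pos by (auto simp del: mult_minus_left)
    hence d: "x div c = - snd l" "x mod c = r" unfolding x_def by auto
    have "(fst l, x, y) \<in> X" using u unfolding X_def x_def y_def shifted_line_def by auto
    moreover have "u = f (fst l, x, y)" unfolding f_def u using d by (simp add: y_def)
    ultimately show "\<exists>t\<in>X. u = f t" by blast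
  qed
  show ?thesis using bij_betw_same_card[OF bij] unfolding cX cN by (rule sym)
qed

end

section \<open>Tanner graphs\<close>

text \<open>Distinct nodes make the edges distinct; the list repeats \<open>v0\<close> at the end
  because the walk has to satisfy \<open>p 4 = p 0\<close>.\<close>

lemma local_cycle_4:
  assumes "adj v0 v1" "adj v1 v2" "adj v2 v3" "adj v3 v0" "distinct [v0, v1, v2, v3]"
  shows "local_cycle adj 4 (\<lambda>j. [v0, v1, v2, v3, v0] ! j)"
proof -
  have "{..<4} = {0, 1, 2, 3::nat}" by auto
  thus ?thesis unfolding local_cycle_def using assms
    by (auto simp: All_less_Suc numeral_eq_Suc inj_on_def doubleton_eq_iff)
qed

lemma local_cycle_6:
  assumes "adj v0 v1" "adj v1 v2" "adj v2 v3" "adj v3 v4" "adj v4 v5" "adj v5 v0"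
    "distinct [v0, v1, v2, v3, v4, v5]"
  shows "local_cycle adj 6 (\<lambda>j. [v0, v1, v2, v3, v4, v5, v0] ! j)"
proof -
  have "{..<6} = {0, 1, 2, 3, 4, 5::nat}" by auto
  thus ?thesis unfolding local_cycle_def using assms
    by (auto simp: All_less_Suc numeral_eq_Suc inj_on_def doubleton_eq_iff)
qed

text \<open>With these sets, the line \<open>(i, t)\<close> for \<open>t \<ge> 0\<close> is the
  column \<open>(t, i)\<close> of the parity-check matrix, and its points are the rows having a 1
  there.\<close>

definition ones :: "bit mat \<Rightarrow> nat \<Rightarrow> int set" where
  "ones Hs i = int ` {j. j < dim_col Hs \<and> Hs $$ (i, j) = 1}"

lemma tanner_adj_sym: "tanner_adj Hs c u v \<longleftrightarrow> tanner_adj Hs c v u"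
  unfolding tanner_adj_def by blast

lemma tanner_adj_line:
  assumes "x \<in> shifted_line {..<dim_row Hs} (ones Hs) (int c) (i, t)" "0 \<le> t"
  shows "0 \<le> x" "tanner_adj Hs c (Row (nat x)) (Col (nat t, i))"
proof -
  obtain j where j: "i < dim_row Hs" "j < dim_col Hs" "Hs $$ (i, j) = 1" "x = t * int c + int j"
    using assms(1) unfolding shifted_line_def ones_def by (auto simp: algebra_simps)
  have x: "x = int (nat t * c + j)" using j(4) assms(2) by simp
  thus "0 \<le> x" by simp
  have "nat x = nat t * c + j" unfolding x by (rule nat_int)
  hence "parity_check Hs c (nat x) (nat t, i) = 1" unfolding parity_check_def using j by simp
  thus "tanner_adj Hs c (Row (nat x)) (Col (nat t, i))" unfolding tanner_adj_def using j(1) by blast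
qed

text \<open>A violation of \<open>two_lines\<close> or \<open>three_lines\<close> is a local cycle
  of length 4 or 6, alternating between rows and columns.\<close>

lemma shifted_lines_of_matrix:
  assumes c: "0 < c" "c \<le> dim_col Hs"
    and acyc: "\<not> (\<exists>k p. k < 8 \<and> local_cycle (tanner_adj Hs c) k p)"
  shows "shifted_lines {..<dim_row Hs} (ones Hs) (int c) (int (dim_col Hs div c)) (int (dim_col Hs mod c))"
proof
  let ?line = "shifted_line {..<dim_row Hs} (ones Hs) (int c)"
  show "finite {..<dim_row Hs}" by simp
  show "0 < int c" "0 \<le> int (dim_col Hs mod c)" "int (dim_col Hs mod c) < int c" using c by auto
  have "1 \<le> dim_col Hs div c" using c by (simp add: Suc_le_eq div_greater_zero_iff)
  thus "1 \<le> int (dim_col Hs div c)" by linarith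
  show "ones Hs i \<subseteq> {0..<int (dim_col Hs div c) * int c + int (dim_col Hs mod c)}" for i
    unfolding ones_def by (auto simp flip: of_nat_mult of_nat_add)
  \<comment> \<open>\<open>H\<close> has rows and column blocks with nonnegative index only, so a configuration of lines has
    to be shifted into this range.\<close>
  have inc: "0 \<le> x + k * int c \<and> tanner_adj Hs c (Row (nat (x + k * int c))) (Col (nat (snd l + k), fst l))"
    if "x \<in> ?line l" "\<bar>snd l\<bar> \<le> k" for x l k
  proof -
    have "x + k * int c \<in> ?line (fst l, snd l + k)"
      using that unfolding shifted_line_def by (simp add: algebra_simps)
    thus ?thesis using tanner_adj_line that(2) by fastforce
  qed
  have col: "(nat (snd l + k), fst l) \<noteq> (nat (snd l' + k), fst l')"
    if "l \<noteq> l'" "\<bar>snd l\<bar> \<le> k" "\<bar>snd l'\<bar> \<le> k" for l l' :: "nat \<times> int" and k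
    using that by (cases l, cases l') auto
  show "x = y" if ne: "l \<noteq> l'" and xy: "x \<in> ?line l" "x \<in> ?line l'" "y \<in> ?line l" "y \<in> ?line l'" for l l' x y
  proof (rule ccontr)
    assume "x \<noteq> y"
    define k where "k = \<bar>snd l\<bar> + \<bar>snd l'\<bar>"
    have k: "\<bar>snd l\<bar> \<le> k" "\<bar>snd l'\<bar> \<le> k" unfolding k_def by auto
    note i = inc[OF xy(1) k(1)] inc[OF xy(2) k(2)] inc[OF xy(3) k(1)] inc[OF xy(4) k(2)]
    have "local_cycle (tanner_adj Hs c) 4
      (\<lambda>j. [Row (nat (x + k * int c)), Col (nat (snd l + k), fst l), Row (nat (y + k * int c)),
        Col (nat (snd l' + k), fst l'), Row (nat (x + k * int c))] ! j)"
      using i \<open>x \<noteq> y\<close> col[OF ne k] tanner_adj_sym[of Hs c]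
      by (intro local_cycle_4) (auto simp: nat_eq_iff)
    moreover have "(4::nat) < 8" by simp
    ultimately show False using acyc by blast
  qed
  show False if ne: "l1 \<noteq> l2" "l2 \<noteq> l3" "l3 \<noteq> l1" and xyz: "x \<noteq> y" "y \<noteq> z" "z \<noteq> x"
    and m: "x \<in> ?line l1" "x \<in> ?line l2" "y \<in> ?line l2" "y \<in> ?line l3" "z \<in> ?line l3" "z \<in> ?line l1"
    for l1 l2 l3 x y z
  proof -
    define k where "k = \<bar>snd l1\<bar> + \<bar>snd l2\<bar> + \<bar>snd l3\<bar>"
    have k: "\<bar>snd l1\<bar> \<le> k" "\<bar>snd l2\<bar> \<le> k" "\<bar>snd l3\<bar> \<le> k" unfolding k_def by auto
    note i = inc[OF m(1) k(1)] inc[OF m(2) k(2)] inc[OF m(3) k(2)] inc[OF m(4) k(3)] inc[OF m(5) k(3)] inc[OF m(6) k(1)]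
    have "local_cycle (tanner_adj Hs c) 6
      (\<lambda>j. [Row (nat (x + k * int c)), Col (nat (snd l2 + k), fst l2), Row (nat (y + k * int c)),
        Col (nat (snd l3 + k), fst l3), Row (nat (z + k * int c)), Col (nat (snd l1 + k), fst l1),
        Row (nat (x + k * int c))] ! j)"
      using i xyz col[OF ne(1) k(1,2)] col[OF ne(2) k(2,3)] col[OF ne(3) k(3,1)] tanner_adj_sym[of Hs c]
      by (intro local_cycle_6) (auto simp: nat_eq_iff)
    moreover have "(6::nat) < 8" by simp
    ultimately show False using acyc by blast
  qed
qed

lemma card_ones: "card (ones Hs i) = row_weight Hs i"
  unfolding ones_def row_weight_def by (intro card_image) auto

theorem mainTheorem3:
  fixes a c L\<^sub>h :: nat and Hs :: "bit mat" and w :: "nat \<Rightarrow> nat"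
  assumes "a > c" and "c > 1" and "L\<^sub>h > c"
    and "Hs \<in> carrier_mat a L\<^sub>h"
    and "\<And>i. i < a \<Longrightarrow> row_weight Hs i = w i"
    and "\<And>i. i < a \<Longrightarrow> w i \<ge> 1"
    and "\<not> (\<exists>k p. k < 8 \<and> local_cycle (tanner_adj Hs c) k p)"
  shows "int L\<^sub>h \<ge> max (int c + 1) \<lceil>real (2 * (\<Sum>i<a. w i choose 2)) / real c\<rceil>"
proof -
  have dims: "dim_row Hs = a" "dim_col Hs = L\<^sub>h" using assms(4) by auto
  interpret shifted_lines "{..<a}" "ones Hs" "int c" "int (L\<^sub>h div c)" "int (L\<^sub>h mod c)"
    using shifted_lines_of_matrix[of c Hs] assms(2,3,7) unfolding dims by simp
  have "2 * (n choose 2) = n * (n - 1)" for n :: nat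
    unfolding choose_two by (cases n) auto
  hence "2 * (\<Sum>i<a. w i choose 2) = (\<Sum>i<a. w i * (w i - 1))"
    unfolding sum_distrib_left by simp
  also have "\<dots> = (\<Sum>i<a. card (ones Hs i) * (card (ones Hs i) - 1))"
    using assms(5) by (intro sum.cong) (auto simp: card_ones)
  \<comment> \<open>Summed over one period, the degrees count every pair of ones within a row of
    \<open>Hs\<close> twice, and the window length is \<open>L\<^sub>h\<close>.\<close>
  also have "int \<dots> \<le> int c * (int (L\<^sub>h div c) * int c + int (L\<^sub>h mod c))"
    using sum_card_nbr_le unfolding sum_card_nbr .
  also have "\<dots> = int (c * L\<^sub>h)" by (simp flip: of_nat_mult of_nat_add)
  finally have "2 * (\<Sum>i<a. w i choose 2) \<le> c * L\<^sub>h" by (simp only: of_nat_le_iff)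
  hence "real (2 * (\<Sum>i<a. w i choose 2)) \<le> real (c * L\<^sub>h)" by (simp only: of_nat_le_iff)
  hence "real (2 * (\<Sum>i<a. w i choose 2)) / real c \<le> real_of_int (int L\<^sub>h)"
    using assms(2) by (simp add: field_simps)
  hence "\<lceil>real (2 * (\<Sum>i<a. w i choose 2)) / real c\<rceil> \<le> int L\<^sub>h" by (rule ceiling_le)
  thus ?thesis using assms(3) by simp
qed

end
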